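(* For all $s,t\in\{1,2,3,\dots\}\cup\{\infty\}$, the set $U(s,t)$ of minimal unsortable permutations is finite. Equivalently, there is a finite set $U$ of permutations such that a permutation $\pi$ is in $\mathcal F(s,t)$ if and only if no element of $U$ is involved in $\pi$.
   Context: Forkstack sorting with capacities $s,t\in\{1,2,3,\dots\}\cup\{\infty\}$: a permutation $\pi=\pi_1\cdots\pi_n$ of $\{1,\dots,n\}$ is placed on an input stack with $\pi_1$ on top; a working stack and an output stack are initially empty. A move either (i) removes the top $k$ elements of the input stack ($1\le k\le s$) and places them as a block, relative order unchanged, on top of the working stack, or (ii) removes the top $l$ elements of the working stack ($1\le l\le t$) and places them as a block, relative order unchanged, on top of the output stack. $\pi$ is sortable if some sequence of moves ends with input and working stacks empty and the output stack reading $1,2,\dots,n$ from top to bottom. $\mathcal F(s,t)$ is the set of all sortable permutations (of all lengths). A permutation $\sigma$ is involved in $\pi$ if $\pi$ has a subsequence of the same length as $\sigma$ whose entries are in the same relative order as the entries of $\sigma$. $\mathcal F(s,t)$ is closed downward under involvement; $U(s,t)$ is the set of permutations not in $\mathcal F(s,t)$ that are minimal with respect to involvement among permutations not in $\mathcal F(s,t)$. *)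

theory Defs
  imports Main "HOL-Library.Extended_Nat" "HOL-Library.Sublist"
begin

definition is_perm :: "nat list \<Rightarrow> bool" where
  "is_perm p \<longleftrightarrow> distinct p \<and> set p = {1..length p}"

(* Configuration (input, working, output); the head of each list is the top of the stack. *)
type_synonym config = "nat list \<times> nat list \<times> nat list"

inductive fs_move :: "enat \<Rightarrow> enat \<Rightarrow> config \<Rightarrow> config \<Rightarrow> bool"
  for s t :: enat where
  push: "\<lbrakk>1 \<le> k; enat k \<le> s; k \<le> length inp\<rbrakk> \<Longrightarrow>
     fs_move s t (inp, w, out) (drop k inp, take k inp @ w, out)"
| pop: "\<lbrakk>1 \<le> l; enat l \<le> t; l \<le> length w\<rbrakk> \<Longrightarrow>
     fs_move s t (inp, w, out) (inp, drop l w, take l w @ out)"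

definition sortable :: "enat \<Rightarrow> enat \<Rightarrow> nat list \<Rightarrow> bool" where
  "sortable s t p \<longleftrightarrow> (fs_move s t)\<^sup>*\<^sup>* (p, [], []) ([], [], [1..<Suc (length p)])"

definition F :: "enat \<Rightarrow> enat \<Rightarrow> nat list set" where
  "F s t = {p. is_perm p \<and> sortable s t p}"

definition order_iso :: "nat list \<Rightarrow> nat list \<Rightarrow> bool" where
  "order_iso a b \<longleftrightarrow> length a = length b \<and>
     (\<forall>i < length a. \<forall>j < length a. a ! i < a ! j \<longleftrightarrow> b ! i < b ! j)"

definition involved :: "nat list \<Rightarrow> nat list \<Rightarrow> bool" where
  "involved \<sigma> \<pi> \<longleftrightarrow> (\<exists>q. subseq q \<pi> \<and> order_iso q \<sigma>)"

definition U :: "enat \<Rightarrow> enat \<Rightarrow> nat list set" where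
  "U s t = {\<sigma>. is_perm \<sigma> \<and> \<sigma> \<notin> F s t \<and>
     (\<forall>\<tau>. is_perm \<tau> \<and> involved \<tau> \<sigma> \<and> \<tau> \<noteq> \<sigma> \<longrightarrow> \<tau> \<in> F s t)}"

end

theory Submission
  imports Defs
begin

text \<open>
  A sorting is determined by a schedule, that is, by the division of the input into the blocks that
  are pushed together: popping as early as possible is never worse. The working stack is then ordered
  by block, and a schedule works iff, whenever a smaller value lies above a larger one that is still
  on the stack, all values in between lie between them, no more than t in number.

  For finiteness one shows that a permutation has a schedule if all its subpermutations of bounded
  length have one. Cut the permutation into zones, at the ascents that are not by one and after the
  right-to-left maxima; these cuts may be made without loss. Inside a zone the entries form
  decreasing layers of runs of consecutive values. The demands that one zone makes on the earlier
  ones do not depend on how the zones are divided into blocks, so the zones can be treated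
  independently. In each zone one of very few divisions works (a single block, one block per run,
  single entries, or a division copied from a bounded subpermutation), and if none of them did, a
  bounded number of entries would witness it.
\<close>

section \<open>Schedules\<close>

text \<open>Schedules of different small subpermutations cannot simply be glued: they may divide a
  zone in incompatible ways, and once the entries that justify a cut are deleted, a schedule need
  not respect the cut. The latter is met by certificates: for each pair of positions, three further
  entries enforce a cut between them and six enforce a stacking order imposed by another zone. A set
  of at most \<open>K\<close> positions thus grows by at most \<open>9 * (K * K)\<close> entries
  into one whose schedules, once normalised at the maxima, respect on the original set the cuts and
  orders of the whole permutation; hence the bound \<open>K + 9 * (K * K)\<close> on the length of a
  basis element. The former difficulty disappears because zones interact through values and zone
  numbers alone (\<open>forced\<close>), and because a zone with a descent leaves little freedom:
  either its smallest entry is pushed later than its largest, and then the zone is stacked in sorted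
  order, or both are in one block, and then at most one other block occurs. \<open>K\<close> exceeds
  a few multiples of each finite capacity, which is all that the counting needs.\<close>

definition on_top :: "(nat \<Rightarrow> nat) \<Rightarrow> nat \<Rightarrow> nat \<Rightarrow> bool" where
  "on_top g i j \<longleftrightarrow> g j < g i \<or> g i = g j \<and> i < j"

lemma on_top_asym: "on_top g i j \<Longrightarrow> \<not> on_top g j i"
  by (auto simp: on_top_def)

text \<open>The larger entry \<open>j\<close> lies under \<open>i\<close> and is still on the stack
  when \<open>i\<close> arrives: it arrives in the same block, or a larger value \<open>k\<close>,
  which has to be output before \<open>j\<close>, is pushed no earlier than \<open>i\<close>. As
  \<open>j\<close> must also end up under \<open>i\<close> in the output, a single pop has to take
  both.\<close>

definition inverted :: "(nat \<Rightarrow> nat) \<Rightarrow> nat set \<Rightarrow> (nat \<Rightarrow> nat) \<Rightarrow> nat \<Rightarrow> nat \<Rightarrow> bool" where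
  "inverted v I g i j \<longleftrightarrow> i \<in> I \<and> j \<in> I \<and> on_top g i j \<and> v i < v j \<and>
     (g i = g j \<or> (\<exists>k\<in>I. g i \<le> g k \<and> v j < v k))"

text \<open>Pop times are eliminated; only block labels remain, and labels may be skipped. The
  second and third clauses say that the values spanned by an inverted pair can leave in one pop. The
  index set is arbitrary so that subpermutations need no renumbering.\<close>

definition schedule :: "enat \<Rightarrow> enat \<Rightarrow> (nat \<Rightarrow> nat) \<Rightarrow> nat set \<Rightarrow> (nat \<Rightarrow> nat) \<Rightarrow> bool" where
  "schedule s t v I g \<longleftrightarrow>
     (\<forall>i\<in>I. \<forall>j\<in>I. i \<le> j \<longrightarrow> g i \<le> g j) \<and>
     (\<forall>i j. \<forall>w\<in>I. inverted v I g i j \<longrightarrow> v i < v w \<longrightarrow> v w < v j \<longrightarrow> on_top g i w \<and> on_top g w j) \<and>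
     (\<forall>i j. inverted v I g i j \<longrightarrow> enat (card {w\<in>I. v i \<le> v w \<and> v w \<le> v j}) \<le> t) \<and>
     (\<forall>c. enat (card {i\<in>I. g i = c}) \<le> s)"

lemma schedule_mono: "schedule s t v I g \<Longrightarrow> i \<in> I \<Longrightarrow> j \<in> I \<Longrightarrow> i \<le> j \<Longrightarrow> g i \<le> g j"
  by (auto simp: schedule_def)

lemma schedule_between:
  assumes "schedule s t v I g" "inverted v I g i j" "w \<in> I" "v i < v w" "v w < v j"
  shows "on_top g i w" "on_top g w j"
  using assms unfolding schedule_def by blast+

lemma schedule_run: "schedule s t v I g \<Longrightarrow> inverted v I g i j
    \<Longrightarrow> enat (card {w\<in>I. v i \<le> v w \<and> v w \<le> v j}) \<le> t"
  unfolding schedule_def by blast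

lemma schedule_block: "schedule s t v I g \<Longrightarrow> enat (card {i\<in>I. g i = c}) \<le> s"
  unfolding schedule_def by blast

text \<open>Deleting entries only removes obligations: inverted pairs, value ranges and blocks of
  the smaller pattern map injectively into those of the larger. This serves for restriction to
  subsets, for involved permutations and for undoing a standardisation.\<close>

lemma schedule_embed:
  assumes sch: "schedule s t v' J g" and J: "finite J"
    and maps: "\<And>i. i \<in> I \<Longrightarrow> f i \<in> J"
    and mono: "\<And>i j. i \<in> I \<Longrightarrow> j \<in> I \<Longrightarrow> i < j \<Longrightarrow> f i < f j"
    and val: "\<And>i j. i \<in> I \<Longrightarrow> j \<in> I \<Longrightarrow> v i < v j \<longleftrightarrow> v' (f i) < v' (f j)"
  shows "schedule s t v I (g \<circ> f)"
proof -
  have inj: "inj_on f I"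
    by (rule inj_onI) (metis less_irrefl mono nat_neq_iff)
  have mono': "f i \<le> f j" if "i \<in> I" "j \<in> I" "i \<le> j" for i j
    using mono that by (metis le_less)
  have lt: "f i < f j \<longleftrightarrow> i < j" if "i \<in> I" "j \<in> I" for i j
    using mono mono' that by (metis not_less)
  have le: "v i \<le> v j \<longleftrightarrow> v' (f i) \<le> v' (f j)" if "i \<in> I" "j \<in> I" for i j
    using val that by (metis not_less)
  have ab: "on_top (g \<circ> f) i j \<longleftrightarrow> on_top g (f i) (f j)" if "i \<in> I" "j \<in> I" for i j
    using that by (auto simp: on_top_def lt)
  have inv: "inverted v' J g (f i) (f j)" if "inverted v I (g \<circ> f) i j" for i j
    using that maps val ab unfolding inverted_def by fastforce
  have cle: "card A \<le> card B" if "A \<subseteq> I" "f ` A \<subseteq> B" "B \<subseteq> J" for A B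
    by (rule card_inj_on_le[of f]) (use that inj J in \<open>auto intro: inj_on_subset finite_subset\<close>)
  show ?thesis
    unfolding schedule_def
  proof (intro conjI ballI allI impI)
    fix i j assume "i \<in> I" "j \<in> I" "i \<le> j"
    then show "(g \<circ> f) i \<le> (g \<circ> f) j"
      using schedule_mono[OF sch] maps mono' by simp
  next
    fix i j w assume a: "w \<in> I" "inverted v I (g \<circ> f) i j" "v i < v w" "v w < v j"
    then have ij: "i \<in> I" "j \<in> I" by (auto simp: inverted_def)
    show "on_top (g \<circ> f) i w" "on_top (g \<circ> f) w j"
      using schedule_between[OF sch inv[OF a(2)], of "f w"] a ij maps val ab by auto
  next
    fix i j assume a: "inverted v I (g \<circ> f) i j"
    then have ij: "i \<in> I" "j \<in> I" by (auto simp: inverted_def)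
    have "card {w \<in> I. v i \<le> v w \<and> v w \<le> v j} \<le> card {w \<in> J. v' (f i) \<le> v' w \<and> v' w \<le> v' (f j)}"
      by (rule cle) (use le ij maps in auto)
    then show "enat (card {w \<in> I. v i \<le> v w \<and> v w \<le> v j}) \<le> t"
      using schedule_run[OF sch inv[OF a]] by (meson enat_ord_simps(1) order_trans)
  next
    fix c
    have "card {i \<in> I. (g \<circ> f) i = c} \<le> card {i \<in> J. g i = c}"
      by (rule cle) (use maps in auto)
    then show "enat (card {i \<in> I. (g \<circ> f) i = c}) \<le> s"
      using schedule_block[OF sch] by (meson enat_ord_simps(1) order_trans)
  qed
qed

text \<open>The label g i is the time at which position i is pushed, h i the time at which it is popped.
  The positions below m have been pushed, T is the current time.\<close>

definition history :: "enat \<Rightarrow> enat \<Rightarrow> nat \<Rightarrow> nat list \<Rightarrow> nat list \<Rightarrow> nat \<Rightarrow> (nat \<Rightarrow> nat) \<Rightarrow> (nat \<Rightarrow> nat) \<Rightarrow> bool" where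
  "history s t m ws os T g h \<longleftrightarrow>
     distinct (ws @ os) \<and> set ws \<union> set os = {..<m} \<and>
     (\<forall>i<m. g i < T) \<and> (\<forall>i j. i \<le> j \<longrightarrow> j < m \<longrightarrow> g i \<le> g j) \<and>
     (\<forall>c. enat (card {i. i < m \<and> g i = c}) \<le> s) \<and> sorted_wrt (on_top g) ws \<and>
     (\<forall>i\<in>set os. g i < h i \<and> h i < T) \<and>
     (\<forall>c. enat (card {i\<in>set os. h i = c}) \<le> t) \<and>
     sorted_wrt (\<lambda>i j. h j < h i \<or> h i = h j \<and> on_top g i j) os \<and>
     (\<forall>i\<in>set os. \<forall>j\<in>set os. on_top g i j \<longrightarrow> g i < h j \<longrightarrow> h i \<le> h j) \<and>
     (\<forall>i\<in>set ws. \<forall>j\<in>set os. on_top g i j \<longrightarrow> h j \<le> g i)"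

text \<open>The label \<open>T\<close> is given to all positions from \<open>m\<close> on, including
  those still in the input; later pushes overwrite these, and no clause of \<open>history\<close>
  looks at a position that has not been pushed.\<close>

lemma history_push:
  assumes H: "history s t m ws os T g h" and k: "1 \<le> k" "enat k \<le> s"
  shows "history s t (m + k) ([m..<m+k] @ ws) os (Suc T) (\<lambda>i. if m \<le> i then T else g i) h"
proof -
  let ?g = "\<lambda>i. if m \<le> i then T else g i"
  have set: "set ws \<union> set os = {..<m}" and dist: "distinct (ws @ os)"
    and gT: "\<And>i. i < m \<Longrightarrow> g i < T" and mono: "\<And>i j. i \<le> j \<Longrightarrow> j < m \<Longrightarrow> g i \<le> g j"
    and cs: "\<And>c. enat (card {i. i < m \<and> g i = c}) \<le> s" and so: "sorted_wrt (on_top g) ws"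
    and hT: "\<And>i. i \<in> set os \<Longrightarrow> g i < h i \<and> h i < T"
    and so2: "sorted_wrt (\<lambda>i j. h j < h i \<or> h i = h j \<and> on_top g i j) os"
    and rest: "\<And>i j. i \<in> set os \<Longrightarrow> j \<in> set os \<Longrightarrow> on_top g i j \<Longrightarrow> g i < h j \<Longrightarrow> h i \<le> h j"
       "\<And>i j. i \<in> set ws \<Longrightarrow> j \<in> set os \<Longrightarrow> on_top g i j \<Longrightarrow> h j \<le> g i"
       "\<And>c. enat (card {i\<in>set os. h i = c}) \<le> t"
    using H unfolding history_def by auto
  have old: "i < m" if "i \<in> set ws \<or> i \<in> set os" for i using set that by blast
  have ab: "on_top ?g i j \<longleftrightarrow> on_top g i j" if "i < m" "j < m" for i j
    using that by (auto simp: on_top_def)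
  have card: "enat (card {i. i < m + k \<and> ?g i = c}) \<le> s" for c
  proof (cases "c = T")
    case True
    have "g i \<noteq> T" if "i < m" for i using gT[OF that] by simp
    then have "{i. i < m + k \<and> ?g i = c} = {m..<m+k}"
      unfolding True by (auto simp: not_less[symmetric])
    then show ?thesis using k by simp
  next
    case False
    then have "{i. i < m + k \<and> ?g i = c} = {i. i < m \<and> g i = c}" by auto
    then show ?thesis using cs by simp
  qed
  have "set [m..<m+k] \<inter> (set ws \<union> set os) = {}" unfolding set by auto
  then have 1: "distinct (([m..<m+k] @ ws) @ os)" using dist by auto
  have "set ([m..<m+k] @ ws) \<union> set os = {m..<m+k} \<union> {..<m}" unfolding set[symmetric] by auto
  also have "\<dots> = {..<m+k}" by auto
  finally have 2: "set ([m..<m+k] @ ws) \<union> set os = {..<m+k}" .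
  have 3: "sorted_wrt (on_top ?g) ([m..<m+k] @ ws)"
  proof -
    have "sorted_wrt (on_top ?g) ws"
      by (rule sorted_wrt_mono_rel[OF _ so]) (simp add: ab old)
    moreover have "sorted_wrt (on_top ?g) [m..<m+k]"
      by (rule sorted_wrt_mono_rel[OF _ sorted_wrt_upt]) (auto simp: on_top_def)
    moreover have "on_top ?g i j" if "i \<in> set [m..<m+k]" "j \<in> set ws" for i j
      using that gT[of j] old[of j] by (auto simp: on_top_def)
    ultimately show ?thesis unfolding sorted_wrt_append by blast
  qed
  have 4: "sorted_wrt (\<lambda>i j. h j < h i \<or> h i = h j \<and> on_top ?g i j) os"
    by (rule sorted_wrt_mono_rel[OF _ so2]) (simp add: ab old)
  have 5: "h j \<le> ?g i" if "i \<in> set ([m..<m+k] @ ws)" "j \<in> set os" "on_top ?g i j" for i j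
  proof (cases "m \<le> i")
    case True then show ?thesis using hT[OF that(2)] by simp
  next
    case False
    then show ?thesis using that ab[of i j] old rest(2) by auto
  qed
  show ?thesis
    unfolding history_def
  proof (intro conjI allI impI ballI)
    fix i j assume "i \<le> j" "j < m + k"
    then show "?g i \<le> ?g j" using mono[of i j] gT[of i] by auto
  next
    fix i assume "i \<in> set os"
    then show "?g i < h i" "h i < Suc T" using hT[of i] old[of i] by auto
  next
    fix i j assume "i \<in> set os" "j \<in> set os" "on_top ?g i j" "?g i < h j"
    then show "h i \<le> h j" using rest(1)[of i j] old[of i] old[of j] ab[of i j] by auto
  next
    fix i show "?g i < Suc T" if "i < m + k" using gT[of i] by auto
  qed (fact 1 2 3 4 5 card rest(3))+
qed

lemma history_pop:
  assumes H: "history s t m ws os T g h" and l: "enat l \<le> t" "l \<le> length ws"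
  shows "history s t m (drop l ws) (take l ws @ os) (Suc T) g (\<lambda>i. if i \<in> set (take l ws) then T else h i)"
proof -
  let ?A = "take l ws" and ?B = "drop l ws"
  let ?h = "\<lambda>i. if i \<in> set ?A then T else h i"
  have set: "set ws \<union> set os = {..<m}" and dist: "distinct (ws @ os)"
    and gT: "\<And>i. i < m \<Longrightarrow> g i < T" and mono: "\<And>i j. i \<le> j \<Longrightarrow> j < m \<Longrightarrow> g i \<le> g j"
    and cs: "\<And>c. enat (card {i. i < m \<and> g i = c}) \<le> s" and so: "sorted_wrt (on_top g) ws"
    and hT: "\<And>i. i \<in> set os \<Longrightarrow> g i < h i \<and> h i < T"
    and so2: "sorted_wrt (\<lambda>i j. h j < h i \<or> h i = h j \<and> on_top g i j) os"
    and lifo: "\<And>i j. i \<in> set os \<Longrightarrow> j \<in> set os \<Longrightarrow> on_top g i j \<Longrightarrow> g i < h j \<Longrightarrow> h i \<le> h j"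
    and gone: "\<And>i j. i \<in> set ws \<Longrightarrow> j \<in> set os \<Longrightarrow> on_top g i j \<Longrightarrow> h j \<le> g i"
    and ct: "\<And>c. enat (card {i\<in>set os. h i = c}) \<le> t"
    using H unfolding history_def by auto
  have old: "i < m" if "i \<in> set ws \<or> i \<in> set os" for i using set that by blast
  have ws: "set ws = set ?A \<union> set ?B" by (metis append_take_drop_id set_append)
  have A: "i \<in> set ws" if "i \<in> set ?A" for i using ws that by blast
  have disj: "i \<notin> set os" if "i \<in> set ?A" for i using dist A[OF that] by auto
  have so': "sorted_wrt (on_top g) (?A @ ?B)" using so by simp
  have h_os: "?h i = h i" if "i \<in> set os" for i using disj that by auto
  have perm: "distinct (?B @ ?A @ os)" "set ?B \<union> set (?A @ os) = {..<m}"
  proof -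
    have "distinct ((?A @ ?B) @ os)" using dist by simp
    then show "distinct (?B @ ?A @ os)" unfolding distinct_append set_append by blast
    show "set ?B \<union> set (?A @ os) = {..<m}" unfolding set[symmetric] ws by auto
  qed
  have card: "enat (card {i\<in>set (?A @ os). ?h i = c}) \<le> t" for c
  proof (cases "c = T")
    case True
    have "{i\<in>set (?A @ os). ?h i = c} = set ?A" using True by (auto dest: hT)
    moreover have "card (set ?A) \<le> l" by (metis card_length length_take min.cobounded2 order_trans)
    ultimately show ?thesis using l(1) by (metis enat_ord_simps(1) order_trans)
  next
    case False
    then have "{i\<in>set (?A @ os). ?h i = c} = {i\<in>set os. h i = c}" using disj by auto
    then show ?thesis using ct by simp
  qed
  have sorted: "sorted_wrt (\<lambda>i j. ?h j < ?h i \<or> ?h i = ?h j \<and> on_top g i j) (?A @ os)"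
  proof -
    have "sorted_wrt (\<lambda>i j. ?h j < ?h i \<or> ?h i = ?h j \<and> on_top g i j) os"
      by (rule sorted_wrt_mono_rel[OF _ so2]) (simp add: h_os)
    moreover have "sorted_wrt (on_top g) ?A" using so' by (simp add: sorted_wrt_append)
    then have "sorted_wrt (\<lambda>i j. ?h j < ?h i \<or> ?h i = ?h j \<and> on_top g i j) ?A"
      by (rule sorted_wrt_mono_rel[rotated]) simp
    ultimately show ?thesis using hT h_os by (simp add: sorted_wrt_append)
  qed
  have asym: "\<not> on_top g i j" if "i \<in> set ?B" "j \<in> set ?A" for i j
    using so' that on_top_asym unfolding sorted_wrt_append by blast
  show ?thesis
    unfolding history_def
  proof (intro conjI allI impI ballI)
    fix i assume "i \<in> set (?A @ os)"
    then show "g i < ?h i" "?h i < Suc T"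
      using hT[of i] gT[of i] A[of i] old[of i] by auto
  next
    fix i j assume ij: "i \<in> set (?A @ os)" "j \<in> set (?A @ os)" "on_top g i j" "g i < ?h j"
    \<comment> \<open>If \<open>j\<close> leaves now, its pop time is the current one and bounds all
      others. If \<open>j\<close> left before and \<open>i\<close> leaves now, then \<open>i\<close>
      was still on the stack, so \<open>j\<close> had gone before \<open>i\<close> came, against
      \<open>g i < ?h j\<close>.\<close>
    show "?h i \<le> ?h j"
    proof (cases "j \<in> set ?A")
      case True
      then show ?thesis using ij(1) hT[of i] by auto
    next
      case False
      then have "j \<in> set os" using ij by auto
      then show ?thesis using ij A[of i] gone[of i j] lifo[of i j] h_os by (cases "i \<in> set ?A") auto
    qed
  next
    fix i j assume "i \<in> set ?B" "j \<in> set (?A @ os)" "on_top g i j"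
    moreover from this have "j \<in> set os" using asym[of i j] by auto
    moreover have "i \<in> set ws" using calculation(1) by (rule in_set_dropD)
    ultimately show "?h j \<le> g i" using h_os[of j] gone[of i j] by simp
  next
    fix i show "g i < Suc T" if "i < m" using gT[OF that] by simp
  next
    show "sorted_wrt (on_top g) ?B" using so' by (simp add: sorted_wrt_append)
  qed (fact perm card sorted cs mono)+
qed

section \<open>Reading a schedule off a sequence of moves\<close>

lemma reachable_history:
  assumes "(fs_move s t)\<^sup>*\<^sup>* (p, [], []) c"
  shows "\<exists>m ws os T g h. c = (drop m p, map ((!) p) ws, map ((!) p) os) \<and> m \<le> length p \<and>
    history s t m ws os T g h"
  using assms
proof (induction rule: rtranclp_induct)
  case base
  have "history s t 0 [] [] 0 (\<lambda>_. 0) (\<lambda>_. 0)" by (simp add: history_def zero_enat_def[symmetric])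
  then show ?case by force
next
  case (step c c')
  then obtain m ws os T g h where c: "c = (drop m p, map ((!) p) ws, map ((!) p) os)"
    and m: "m \<le> length p" and H: "history s t m ws os T g h" by blast
  from step.hyps(2) show ?case
    unfolding c
  proof cases
    case (push k)
    have "map ((!) p) [m..<m+k] = take k (drop m p)"
      by (rule nth_equalityI) (use push m in auto)
    then have "c' = (drop (m + k) p, map ((!) p) ([m..<m+k] @ ws), map ((!) p) os)"
      using push by (simp add: add.commute)
    moreover have "m + k \<le> length p" using push m by simp
    moreover have "history s t (m + k) ([m..<m+k] @ ws) os (Suc T) (\<lambda>i. if m \<le> i then T else g i) h"
      by (rule history_push[OF H]) (use push in auto)
    ultimately show ?thesis by blast
  next
    case (pop l)
    then have "c' = (drop m p, map ((!) p) (drop l ws), map ((!) p) (take l ws @ os))"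
      by (simp add: drop_map take_map)
    moreover have "history s t m (drop l ws) (take l ws @ os) (Suc T) g (\<lambda>i. if i \<in> set (take l ws) then T else h i)"
      by (rule history_pop[OF H]) (use pop in auto)
    ultimately show ?thesis using m by blast
  qed
qed

lemma sortable_imp_schedule:
  assumes "sortable s t p"
  shows "\<exists>g. schedule s t ((!) p) {..<length p} g"
proof -
  let ?n = "length p" and ?v = "(!) p"
  obtain m ws os T g h where eq: "([], [], [1..<Suc ?n]) = (drop m p, map ?v ws, map ?v os)"
    and "m \<le> ?n" and H: "history s t m ws os T g h"
    using reachable_history[OF assms[unfolded sortable_def]] by metis
  have m: "m = ?n" and ws: "ws = []" and os: "map ?v os = [1..<Suc ?n]"
    using eq \<open>m \<le> ?n\<close> by auto
  have set: "set os = {..<?n}" and mono: "\<And>i j. i \<le> j \<Longrightarrow> j < ?n \<Longrightarrow> g i \<le> g j"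
    and cs: "\<And>c. enat (card {i. i < ?n \<and> g i = c}) \<le> s"
    and gh: "\<And>i. i < ?n \<Longrightarrow> g i < h i"
    and so: "sorted_wrt (\<lambda>i j. h j < h i \<or> h i = h j \<and> on_top g i j) os"
    and lifo: "\<And>i j. i < ?n \<Longrightarrow> j < ?n \<Longrightarrow> on_top g i j \<Longrightarrow> g i < h j \<Longrightarrow> h i \<le> h j"
    and ct: "\<And>c. enat (card {i. i < ?n \<and> h i = c}) \<le> t"
    using H unfolding history_def m ws by auto
  \<comment> \<open>The output reads 1, 2, ... from the top, so the smaller value was output later,
    or in the same pop from a higher place.\<close>
  have out: "h j < h i \<or> h i = h j \<and> on_top g i j" if "i < ?n" "j < ?n" "?v i < ?v j" for i j
  proof -
    have len: "length os = ?n" using arg_cong[OF os, of length] by (simp del: upt_Suc)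
    have "i \<in> set os" "j \<in> set os" unfolding set using that by auto
    then obtain a b where a: "a < ?n" "os ! a = i" and b: "b < ?n" "os ! b = j"
      unfolding in_set_conv_nth len by blast
    have "?v i = Suc a" "?v j = Suc b"
      using arg_cong[OF os, of "\<lambda>l. l ! a"] arg_cong[OF os, of "\<lambda>l. l ! b"] a b len
      by (auto simp del: upt_Suc)
    then have "a < b" using that by simp
    then show ?thesis using sorted_wrt_nth_less[OF so, of a b] a b len by simp
  qed
  have out': "h j \<le> h i" if "i < ?n" "j < ?n" "?v i < ?v j" for i j
    using out[OF that] by auto
  \<comment> \<open>The entry \<open>j\<close> is popped after \<open>i\<close> is pushed, because
    it comes with \<open>i\<close> or has to wait for a larger value that comes no earlier. Last in,
    first out gives \<open>h i \<le> h j\<close>; the output order gives the converse.\<close>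
  have joint: "h i = h j" if inv: "inverted ?v {..<?n} g i j" for i j
  proof -
    have ij: "i < ?n" "j < ?n" "on_top g i j" "?v i < ?v j" using inv by (auto simp: inverted_def)
    have "g i < h j"
    proof (cases "g i = g j")
      case True then show ?thesis using gh ij by simp
    next
      case False
      then obtain k where "k < ?n" "g i \<le> g k" "?v j < ?v k" using inv by (auto simp: inverted_def)
      then show ?thesis using gh[of k] out'[of j k] ij by simp
    qed
    then show ?thesis using lifo[of i j] out'[of i j] ij by simp
  qed
  have within: "h w = h j" if "inverted ?v {..<?n} g i j" "w < ?n" "?v i \<le> ?v w" "?v w \<le> ?v j" for i j w
  proof -
    have ij: "i < ?n" "j < ?n" using that by (auto simp: inverted_def)
    have inj: "inj_on ?v {..<?n}"
    proof (rule eq_card_imp_inj_on)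
      have "?v ` {..<?n} = {1..<Suc ?n}" using arg_cong[OF os, of set] set by (simp del: upt_Suc)
      then show "card (?v ` {..<?n}) = card {..<?n}" by simp
    qed simp
    have "h w \<le> h i" using that ij out'[of i w] inj by (cases "?v i = ?v w") (auto dest: inj_onD)
    moreover have "h j \<le> h w" using that ij out'[of w j] inj by (cases "?v w = ?v j") (auto dest: inj_onD)
    ultimately show ?thesis using joint[OF that(1)] by simp
  qed
  have "schedule s t ?v {..<?n} g"
    unfolding schedule_def
  proof (intro conjI ballI allI impI)
    fix i j w assume a: "w \<in> {..<?n}" "inverted ?v {..<?n} g i j" "?v i < ?v w" "?v w < ?v j"
    then have ij: "i < ?n" "j < ?n" by (auto simp: inverted_def)
    show "on_top g i w" "on_top g w j"
      using a ij joint[OF a(2)] within[OF a(2), of w] out[of i w] out[of w j] by auto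
  next
    fix i j assume a: "inverted ?v {..<?n} g i j"
    have "card {w \<in> {..<?n}. ?v i \<le> ?v w \<and> ?v w \<le> ?v j} \<le> card {w. w < ?n \<and> h w = h j}"
      by (rule card_mono) (use within[OF a] in auto)
    then show "enat (card {w \<in> {..<?n}. ?v i \<le> ?v w \<and> ?v w \<le> ?v j}) \<le> t"
      using ct by (meson enat_ord_simps(1) order_trans)
  next
    fix c show "enat (card {i \<in> {..<?n}. g i = c}) \<le> s" using cs[of c] by simp
  qed (use mono in auto)
  then show ?thesis by blast
qed

section \<open>Simulating a schedule\<close>

text \<open>The working stack is w, the values above m have been output, and no value above m' is left
  in the input. The assumption on triples says that on the stack every inverted pair bounds a run.\<close>

lemma greedy_pop:
  assumes "sorted_wrt (on_top g) w" "distinct w" "inj_on v (set w)" "m \<le> n"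
    and "\<And>x. x \<in> v ` set w \<Longrightarrow> x \<le> m" "{m'<..m} \<subseteq> v ` set w" "m' \<notin> v ` set w" "m' \<le> m"
    and "\<And>i j x. i \<in> set w \<Longrightarrow> j \<in> set w \<Longrightarrow> on_top g i j \<Longrightarrow> v i < x \<Longrightarrow> x < v j \<Longrightarrow>
        \<exists>k\<in>set w. v k = x \<and> on_top g i k \<and> on_top g k j"
    and "\<And>i j. i \<in> set w \<Longrightarrow> j \<in> set w \<Longrightarrow> on_top g i j \<Longrightarrow> v i < v j \<Longrightarrow> enat (Suc (v j - v i)) \<le> t"
    and "1 \<le> t"
  shows "\<exists>w'. (fs_move s t)\<^sup>*\<^sup>* (inp, map v w, [Suc m..<Suc n]) (inp, map v w', [Suc m'..<Suc n]) \<and>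
    sorted_wrt (on_top g) w' \<and> distinct w' \<and> set w' = {i\<in>set w. v i < m'}"
  using assms
proof (induction "length w" arbitrary: w m rule: less_induct)
  case (less w m)
  show ?case
  proof (cases "m' = m")
    case True
    then have "set w = {i\<in>set w. v i < m'}" using less.prems(5,7) by (metis (no_types, lifting) Collect_cong Collect_mem_eq image_eqI le_neq_implies_less)
    then show ?thesis using True less.prems(1,2) by blast
  next
    case False
    then have "m \<in> v ` set w" using less.prems(6,8) by auto
    then obtain j where j: "j \<in> set w" "v j = m" by auto
    then obtain u z where w: "w = u @ j # z" by (metis split_list)
    \<comment> \<open>Everything above the largest value \<open>m\<close> on the stack is smaller,
      so together with \<open>m\<close> it must form a single increasing run; this is the block that
      is popped next.\<close>
    let ?b = "u @ [j]"
    have ord: "on_top g a b" if "a \<in> set ?b" "b \<in> set z" for a b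
      using less.prems(1) that unfolding w by (auto simp: sorted_wrt_append)
    have uj: "on_top g i j" if "i \<in> set u" for i
      using less.prems(1) that unfolding w by (auto simp: sorted_wrt_append)
    have inj: "a = b" if "v a = v b" "a \<in> set w" "b \<in> set w" for a b
      using less.prems(3) that by (auto dest: inj_onD)
    have ujlt: "v i < m" if "i \<in> set u" for i
    proof -
      have "i \<noteq> j" using less.prems(2) w that by auto
      then show ?thesis using less.prems(5)[of "v i"] inj[of i j] that j w by fastforce
    qed
    have le: "v i \<le> m" if "i \<in> set ?b" for i using ujlt[of i] that j by auto
    have sor: "sorted_wrt (\<lambda>a b. v a < v b) ?b"
    proof -
      have "sorted_wrt (on_top g) u" using less.prems(1) w by (simp add: sorted_wrt_append)
      then have "sorted_wrt (\<lambda>a b. v a < v b) u"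
      proof (rule sorted_wrt_mono_rel[rotated])
        fix a b assume ab: "a \<in> set u" "b \<in> set u" "on_top g a b"
        \<comment> \<open>Otherwise \<open>b\<close> lies over \<open>j\<close> with the value of
          \<open>a\<close> between theirs, so \<open>a\<close> would have to lie under
          \<open>b\<close>.\<close>
        show "v a < v b"
        proof (rule ccontr)
          assume n: "\<not> v a < v b"
          have "a \<noteq> b" using ab(3) on_top_asym by blast
          then have "v b < v a" using n inj[of a b] ab w by fastforce
          then obtain k where "k \<in> set w" "v k = v a" "on_top g b k"
            using less.prems(9)[of b j "v a"] ab ujlt[of a] uj[of b] j w by auto
          then show False using inj[of k a] ab w on_top_asym by auto
        qed
      qed
      then show ?thesis using ujlt j by (simp add: sorted_wrt_append)
    qed
    define x where "x = v (hd ?b)"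
    have hd: "hd ?b \<in> set ?b" by (cases u) auto
    have xle: "x \<le> v a" if "a \<in> set ?b" for a
      using sor that unfolding x_def by (cases u) (auto intro: less_imp_le)
    have "v ` set ?b = {x..m}"
    proof
      show "v ` set ?b \<subseteq> {x..m}" using xle le by auto
    next
      show "{x..m} \<subseteq> v ` set ?b"
      proof
        fix y assume y: "y \<in> {x..m}"
        show "y \<in> v ` set ?b"
        proof (cases "y = x \<or> y = m")
          case True then show ?thesis using hd j unfolding x_def by auto
        next
          case False
          then have "x < y" "y < m" using y by auto
          then have "hd ?b \<in> set u" using hd j x_def by auto
          then obtain k where k: "k \<in> set w" "v k = y" "on_top g k j"
            using less.prems(9)[of "hd ?b" j y] uj[of "hd ?b"] j w \<open>x < y\<close> \<open>y < m\<close> x_def by auto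
          then have "k \<notin> set z" using ord[of j k] on_top_asym by auto
          then show ?thesis using k w by auto
        qed
      qed
    qed
    moreover have "sorted_wrt (<) (map v ?b)" using sor by (simp only: sorted_wrt_map)
    ultimately have run: "map v ?b = [x..<Suc m]"
      by (intro strict_sorted_equal) (auto simp: atLeastLessThanSuc_atLeastAtMost simp del: upt_Suc)
    have xm: "x \<le> m" using xle[of j] j by simp
    have len: "length ?b = Suc m - x" using arg_cong[OF run, of length] by (simp del: upt_Suc)
    have lent: "enat (length ?b) \<le> t"
    proof (cases u)
      case Nil then show ?thesis using less.prems(11) by (simp add: one_enat_def)
    next
      case (Cons a u')
      then have a: "hd ?b = a" "a \<in> set u" by auto
      have "enat (Suc (v j - v a)) \<le> t"
        using less.prems(10)[of a j] uj[OF a(2)] ujlt[OF a(2)] j w a by auto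
      then show ?thesis using len a xm j x_def by (simp add: Suc_diff_le)
    qed
    have zle: "v i < x" if "i \<in> set z" for i
    proof (rule ccontr)
      assume "\<not> v i < x"
      then have "v i \<in> {x..m}" using less.prems(5)[of "v i"] that w by auto
      then have "v i \<in> v ` set ?b" using \<open>v ` set ?b = {x..m}\<close> by simp
      then obtain a where "a \<in> set ?b" "v a = v i" by (metis imageE)
      then show False using inj[of a i] less.prems(2) that w by auto
    qed
    have m'x: "m' < x"
    proof (rule ccontr)
      assume "\<not> m' < x"
      then have "m' \<in> v ` set ?b" using \<open>v ` set ?b = {x..m}\<close> less.prems(8) by simp
      then show False using less.prems(7) w by auto
    qed
    have x1: "1 \<le> x" using m'x by simp
    have move: "fs_move s t (inp, map v w, [Suc m..<Suc n]) (inp, map v z, [Suc (x - 1)..<Suc n])"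
    proof -
      have "fs_move s t (inp, map v w, [Suc m..<Suc n])
         (inp, drop (length ?b) (map v w), take (length ?b) (map v w) @ [Suc m..<Suc n])"
        by (rule fs_move.pop) (use lent w in auto)
      moreover have "drop (length ?b) (map v w) = map v z" "take (length ?b) (map v w) = map v ?b"
        using w by auto
      moreover have "map v ?b @ [Suc m..<Suc n] = [Suc (x - 1)..<Suc n]"
        unfolding run using x1 xm less.prems(4) upt_add_eq_append[of x "Suc m" "n - m"] by (simp del: upt_Suc)
      ultimately show ?thesis by simp
    qed
    have "\<exists>w'. (fs_move s t)\<^sup>*\<^sup>* (inp, map v z, [Suc (x-1)..<Suc n]) (inp, map v w', [Suc m'..<Suc n]) \<and>
      sorted_wrt (on_top g) w' \<and> distinct w' \<and> set w' = {i\<in>set z. v i < m'}"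
    proof (rule less.hyps)
      show "length z < length w" using w by simp
      show "sorted_wrt (on_top g) z" "distinct z" "inj_on v (set z)"
        using less.prems(1-3) w by (auto simp: sorted_wrt_append inj_on_Un)
      show "x - 1 \<le> n" using xm less.prems(4) by simp
      show "a \<le> x - 1" if "a \<in> v ` set z" for a using zle that by fastforce
      show "{m'<..x - 1} \<subseteq> v ` set z"
      proof
        fix y assume y: "y \<in> {m'<..x - 1}"
        then have "y \<in> v ` set w" using less.prems(6) xm by auto
        then obtain a where a: "a \<in> set w" "v a = y" by auto
        then have "a \<notin> set ?b" using xle[of a] y x1 by auto
        then show "y \<in> v ` set z" using a w by auto
      qed
      show "m' \<notin> v ` set z" using less.prems(7) w by auto
      show "m' \<le> x - 1" using m'x by simp
    next
      fix i j' y assume a: "i \<in> set z" "j' \<in> set z" "on_top g i j'" "v i < y" "y < v j'"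
      then obtain k where k: "k \<in> set w" "v k = y" "on_top g i k" "on_top g k j'"
        using less.prems(9)[of i j' y] w by auto
      then have "k \<notin> set ?b" using ord[of k i] a on_top_asym by blast
      then show "\<exists>k\<in>set z. v k = y \<and> on_top g i k \<and> on_top g k j'" using k w by auto
    next
      fix i j' assume a: "i \<in> set z" "j' \<in> set z" "on_top g i j'" "v i < v j'"
      then show "enat (Suc (v j' - v i)) \<le> t" using less.prems(10)[of i j'] w by auto
    qed (fact less.prems(11))
    then obtain w' where w': "(fs_move s t)\<^sup>*\<^sup>* (inp, map v z, [Suc (x-1)..<Suc n]) (inp, map v w', [Suc m'..<Suc n])"
      "sorted_wrt (on_top g) w'" "distinct w'" "set w' = {i\<in>set z. v i < m'}" by blast
    have "{i\<in>set z. v i < m'} = {i\<in>set w. v i < m'}"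
      using xle m'x w by fastforce
    then show ?thesis using w' converse_rtranclp_into_rtranclp[OF move w'(1)] by auto
  qed
qed

text \<open>Greedy popping: before block \<open>c\<close> is pushed, exactly the values above
  \<open>mx c\<close>, the largest value yet to come, have been output. The value of
  \<open>mx\<close> is 0 when nothing is left, so at the end everything is out.\<close>

lemma schedule_imp_sortable:
  assumes perm: "is_perm p" and sch: "schedule s t ((!) p) {..<length p} g"
    and t: "1 \<le> t"
  shows "sortable s t p"
proof -
  let ?n = "length p" and ?v = "(!) p"
  define rest where "rest c = filter (\<lambda>i. c \<le> g i) [0..<?n]" for c
  define mx where "mx c = Max (insert 0 (?v ` {i. i < ?n \<and> c \<le> g i}))" for c
  have val: "?v ` {..<?n} = {1..?n}" and inj: "inj_on ?v {..<?n}"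
    using perm unfolding is_perm_def
    by (auto simp: inj_on_nth set_conv_nth)
  have mx_le: "?v i \<le> mx c" if "i < ?n" "c \<le> g i" for i c
    unfolding mx_def by (rule Max_ge) (use that in auto)
  have mx_cases: "mx c = 0 \<or> (\<exists>i<?n. c \<le> g i \<and> mx c = ?v i)" for c
  proof -
    have "mx c \<in> insert 0 (?v ` {i. i < ?n \<and> c \<le> g i})" unfolding mx_def by (rule Max_in) auto
    then show ?thesis by auto
  qed
  have gmono: "g i \<le> g j" if "i \<le> j" "j < ?n" for i j
    using schedule_mono[OF sch, of i j] that by auto
  have rest_split: "rest c = filter (\<lambda>i. g i = c) [0..<?n] @ rest (Suc c)" for c
  proof -
    have "filter (\<lambda>i. c \<le> g i) xs = filter (\<lambda>i. g i = c) xs @ filter (\<lambda>i. Suc c \<le> g i) xs"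
      if "sorted_wrt (\<lambda>i j. g i \<le> g j) xs" for xs
      using that
    proof (induction xs)
      case (Cons a xs)
      show ?case
      proof (cases "c < g a")
        case True
        then have "filter (\<lambda>i. g i = c) xs = []" using Cons.prems by (fastforce simp: filter_empty_conv)
        then show ?thesis using Cons True by simp
      qed (use Cons in auto)
    qed simp
    moreover have "sorted_wrt (\<lambda>i j. g i \<le> g j) [0..<?n]"
      by (rule sorted_wrt_mono_rel[OF _ sorted_wrt_upt]) (use gmono in auto)
    ultimately show ?thesis unfolding rest_def by blast
  qed
  have step: "\<exists>w. (fs_move s t)\<^sup>*\<^sup>* (p, [], []) (map ?v (rest c), map ?v w, [Suc (mx c)..<Suc ?n]) \<and>
     sorted_wrt (on_top g) w \<and> distinct w \<and> set w = {i. i < ?n \<and> g i < c \<and> ?v i < mx c}" for c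
  proof (induction c)
    case 0
    have "rest 0 = [0..<?n]" by (simp add: rest_def)
    moreover have "mx 0 = ?n"
    proof (cases "?n = 0")
      case False
      then have "?n \<in> ?v ` {..<?n}" unfolding val by (simp add: Suc_le_eq)
      then have "?n \<le> mx 0" using mx_le by fastforce
      moreover have "mx 0 \<le> ?n" using mx_cases[of 0] val by auto
      ultimately show ?thesis by simp
    qed (simp add: mx_def)
    ultimately show ?case by (intro exI[of _ "[]"]) (simp add: map_nth del: upt_Suc)
  next
    case (Suc c)
    then obtain w where w: "(fs_move s t)\<^sup>*\<^sup>* (p, [], []) (map ?v (rest c), map ?v w, [Suc (mx c)..<Suc ?n])"
      "sorted_wrt (on_top g) w" "distinct w" "set w = {i. i < ?n \<and> g i < c \<and> ?v i < mx c}" by blast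
    define B where "B = filter (\<lambda>i. g i = c) [0..<?n]"
    define W where "W = B @ w"
    have setB: "set B = {i. i < ?n \<and> g i = c}" by (auto simp: B_def)
    have setW: "set W = {i. i < ?n \<and> g i \<le> c \<and> (g i = c \<or> ?v i < mx c)}"
      unfolding W_def set_append w(4) setB by auto
    have W: "i < ?n" "g i \<le> c" "g i = c \<or> ?v i < mx c" if "i \<in> set W" for i
      using that unfolding setW by blast+
    have push: "(fs_move s t)\<^sup>*\<^sup>* (map ?v (rest c), map ?v w, [Suc (mx c)..<Suc ?n])
       (map ?v (rest (Suc c)), map ?v W, [Suc (mx c)..<Suc ?n])"
    proof (cases "B = []")
      case True
      then show ?thesis using rest_split[of c] by (simp add: W_def B_def)
    next
      case False
      have "distinct B" by (simp add: B_def)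
      then have "length B = card {i \<in> {..<?n}. g i = c}" using setB by (simp add: distinct_card[symmetric])
      then have B: "enat (length B) \<le> s" using schedule_block[OF sch] by simp
      have "fs_move s t (map ?v (rest c), map ?v w, [Suc (mx c)..<Suc ?n])
         (drop (length B) (map ?v (rest c)), take (length B) (map ?v (rest c)) @ map ?v w, [Suc (mx c)..<Suc ?n])"
        by (rule fs_move.push) (use B False rest_split[of c] in \<open>auto simp: B_def Suc_le_eq simp del: upt_Suc\<close>)
      moreover have "drop (length B) (map ?v (rest c)) = map ?v (rest (Suc c))"
        "take (length B) (map ?v (rest c)) @ map ?v w = map ?v W"
        using rest_split[of c] by (auto simp: B_def W_def)
      ultimately show ?thesis by simp
    qed
    have mxn: "mx c \<le> ?n" for c using mx_cases[of c] val by auto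
    \<comment> \<open>If \<open>j\<close> comes from an older block, the entry of value
      \<open>mx c\<close>, which is pushed no earlier than block \<open>c\<close>, is the larger
      value that keeps \<open>j\<close> on the stack.\<close>
    have inv: "inverted ?v {..<?n} g i j" if "i \<in> set W" "j \<in> set W" "on_top g i j" "?v i < ?v j" for i j
    proof -
      have ij: "i < ?n" "j < ?n" "g i \<le> c" "g j \<le> c" using that setW by auto
      have "\<exists>k\<in>{..<?n}. g i \<le> g k \<and> ?v j < ?v k" if "g i \<noteq> g j"
      proof -
        have "g j < c" using that ij \<open>on_top g i j\<close> by (auto simp: on_top_def)
        then have "?v j < mx c" using \<open>j \<in> set W\<close> setW by auto
        then obtain k where "k < ?n" "c \<le> g k" "mx c = ?v k" using mx_cases[of c] by auto
        then show ?thesis using ij \<open>?v j < mx c\<close> by (intro bexI[of _ k]) auto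
      qed
      then show ?thesis using ij that by (auto simp: inverted_def)
    qed
    have inW: "k \<in> set W" if "k < ?n" "g k \<le> c" "?v k < mx c" for k
      using that setW by auto
    have "\<exists>w'. (fs_move s t)\<^sup>*\<^sup>* (map ?v (rest (Suc c)), map ?v W, [Suc (mx c)..<Suc ?n])
        (map ?v (rest (Suc c)), map ?v w', [Suc (mx (Suc c))..<Suc ?n]) \<and>
      sorted_wrt (on_top g) w' \<and> distinct w' \<and> set w' = {i\<in>set W. ?v i < mx (Suc c)}"
    proof (rule greedy_pop)
      have "sorted_wrt (on_top g) B"
        unfolding B_def
        by (rule sorted_wrt_mono_rel[OF _ sorted_wrt_filter[OF sorted_wrt_upt]]) (auto simp: on_top_def)
      then show "sorted_wrt (on_top g) W"
        using w(2,4) setB by (auto simp: W_def sorted_wrt_append on_top_def)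
      show "distinct W" using w(3,4) setB by (auto simp: W_def B_def)
      show "inj_on ?v (set W)" using inj by (rule inj_on_subset) (use setW in auto)
      show "x \<le> mx c" if "x \<in> ?v ` set W" for x using that setW mx_le by fastforce
      show "{mx (Suc c)<..mx c} \<subseteq> ?v ` set W"
      proof
        fix y assume y: "y \<in> {mx (Suc c)<..mx c}"
        then have "y \<in> ?v ` {..<?n}" using val mxn[of c] by auto
        then obtain i where i: "i < ?n" "?v i = y" by auto
        have "\<not> Suc c \<le> g i" using mx_le[of i "Suc c"] i y by auto
        \<comment> \<open>The old stack holds only values strictly below \<open>mx c\<close>, so
          \<open>mx c\<close> itself has to arrive with block \<open>c\<close>.\<close>
        moreover have "g i = c" if ymx: "y = mx c"
        proof -
          obtain k where "k < ?n" "c \<le> g k" "y = ?v k" using mx_cases[of c] ymx y by auto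
          then have "k = i" using i inj by (auto dest: inj_onD)
          then show ?thesis using \<open>c \<le> g k\<close> calculation by simp
        qed
        ultimately have "i \<in> set W" using i y setW by (cases "y = mx c") auto
        then show "y \<in> ?v ` set W" using i by auto
      qed
      show "mx (Suc c) \<notin> ?v ` set W"
      proof
        assume "mx (Suc c) \<in> ?v ` set W"
        then obtain i where i: "i \<in> set W" "?v i = mx (Suc c)" by auto
        then have "i < ?n" "g i \<le> c" using setW by auto
        then have "?v i \<noteq> 0" using val by (metis atLeastAtMost_iff imageI lessThan_iff not_one_le_zero)
        then obtain k where "k < ?n" "Suc c \<le> g k" "?v i = ?v k" using mx_cases[of "Suc c"] i by auto
        then have "k = i" using \<open>i < ?n\<close> inj by (auto dest: inj_onD)
        then show False using \<open>Suc c \<le> g k\<close> \<open>g i \<le> c\<close> by simp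
      qed
      show "mx (Suc c) \<le> mx c"
        unfolding mx_def by (rule Max_mono) auto
      show "mx c \<le> ?n" by (rule mxn)
    next
      fix i j x assume a: "i \<in> set W" "j \<in> set W" "on_top g i j" "?v i < x" "x < ?v j"
      have ij: "i < ?n" "j < ?n" using a setW by auto
      then have "x \<in> {1..?n}" using a val by (metis (no_types, lifting) atLeastAtMost_iff imageI lessThan_iff less_imp_le order_trans)
      then have "x \<in> ?v ` {..<?n}" using val by simp
      then obtain k where k: "k < ?n" "?v k = x" by auto
      have k': "on_top g i k" "on_top g k j"
        using schedule_between[OF sch inv[of i j], of k] a k by auto
      have "g k \<le> c" using k'(1) W(2)[OF a(1)] by (auto simp: on_top_def)
      moreover have "?v k < mx c"
        using a(5) k W(3)[OF a(2)] mx_le[of j c] ij by (cases "g j = c") auto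
      ultimately show "\<exists>k\<in>set W. ?v k = x \<and> on_top g i k \<and> on_top g k j"
        using inW[of k] k k' by blast
    next
      fix i j assume a: "i \<in> set W" "j \<in> set W" "on_top g i j" "?v i < ?v j"
      have ij: "i < ?n" "j < ?n" using a W by auto
      have "?v ` {w \<in> {..<?n}. ?v i \<le> ?v w \<and> ?v w \<le> ?v j} = {?v i..?v j}"
      proof
        show "{?v i..?v j} \<subseteq> ?v ` {w \<in> {..<?n}. ?v i \<le> ?v w \<and> ?v w \<le> ?v j}"
        proof
          fix x assume x: "x \<in> {?v i..?v j}"
          moreover have "?v i \<in> {1..?n}" "?v j \<in> {1..?n}" unfolding val[symmetric] using ij by auto
          ultimately have "x \<in> ?v ` {..<?n}" unfolding val by simp
          then show "x \<in> ?v ` {w \<in> {..<?n}. ?v i \<le> ?v w \<and> ?v w \<le> ?v j}" using x by auto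
        qed
      qed auto
      then have "Suc (?v j) - ?v i \<le> card {w \<in> {..<?n}. ?v i \<le> ?v w \<and> ?v w \<le> ?v j}"
        using card_image_le[of "{w \<in> {..<?n}. ?v i \<le> ?v w \<and> ?v w \<le> ?v j}" ?v] by simp
      then show "enat (Suc (?v j - ?v i)) \<le> t"
        using schedule_run[OF sch inv[OF a]] a(4)
        by (metis (no_types, lifting) Suc_diff_le enat_ord_simps(1) less_imp_le order_trans)
    qed (fact t)
    then obtain w' where w': "(fs_move s t)\<^sup>*\<^sup>* (map ?v (rest (Suc c)), map ?v W, [Suc (mx c)..<Suc ?n])
        (map ?v (rest (Suc c)), map ?v w', [Suc (mx (Suc c))..<Suc ?n])"
      "sorted_wrt (on_top g) w'" "distinct w'" "set w' = {i\<in>set W. ?v i < mx (Suc c)}" by blast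
    have "mx (Suc c) \<le> mx c" unfolding mx_def by (rule Max_mono) auto
    then have "set w' = {i. i < ?n \<and> g i < Suc c \<and> ?v i < mx (Suc c)}"
      unfolding w'(4) setW by auto
    then show ?case using w' rtranclp_trans[OF rtranclp_trans[OF w(1) push] w'(1)] by blast
  qed
  define c where "c = Suc (Max (insert 0 (g ` {..<?n})))"
  have gc: "g i < c" if "i < ?n" for i
    unfolding c_def by (rule le_imp_less_Suc, rule Max_ge) (use that in auto)
  then have none: "\<not> c \<le> g i" if "i < ?n" for i using that by (simp add: not_le)
  then have "{i. i < ?n \<and> c \<le> g i} = {}" by blast
  then have "mx c = 0" unfolding mx_def by (simp only: image_empty Max_singleton)
  moreover have "rest c = []" using none by (simp add: rest_def filter_empty_conv)
  ultimately show ?thesis using step[of c] unfolding sortable_def by auto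
qed

section \<open>Zones and forced positions\<close>

text \<open>The condition on triples is used twice: \<open>j\<close> turns out to be inverted under
  \<open>x\<close> like \<open>y\<close>, and then \<open>i\<close> is squeezed between
  \<open>x\<close> and \<open>j\<close>. So an inverted pair stacks all the values it spans in
  sorted order.\<close>

lemma schedule_chain:
  assumes sch: "schedule s t v I g" and inj: "inj_on v I" and inv: "inverted v I g x y"
    and ij: "i \<in> I" "j \<in> I" "v x \<le> v i" "v i < v j" "v j \<le> v y"
  shows "on_top g i j"
proof -
  have xy: "x \<in> I" "y \<in> I" "on_top g x y" and meet: "g x = g y \<or> (\<exists>k\<in>I. g x \<le> g k \<and> v y < v k)"
    using inv by (auto simp: inverted_def)
  have xj: "on_top g x j"
    using schedule_between(1)[OF sch inv, of j] xy ij inj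
    by (cases "v j = v y") (auto dest: inj_onD)
  have jy: "g y \<le> g j"
    using schedule_between(2)[OF sch inv, of j] xy ij inj
    by (cases "v j = v y") (auto dest: inj_onD simp: on_top_def)
  have "g x = g j \<or> (\<exists>k\<in>I. g x \<le> g k \<and> v j < v k)"
    using meet
  proof
    assume "g x = g y" then show ?thesis using xj jy by (auto simp: on_top_def)
  next
    assume "\<exists>k\<in>I. g x \<le> g k \<and> v y < v k" then show ?thesis using ij(5) by (meson le_less_trans)
  qed
  then have inv': "inverted v I g x j" using xj xy ij by (auto simp: inverted_def)
  show ?thesis
  proof (cases "v x = v i")
    case True
    then have "x = i" using xy ij inj by (auto dest: inj_onD)
    then show ?thesis using xj by simp
  next
    case False
    then show ?thesis using schedule_between(2)[OF sch inv', of i] ij by simp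
  qed
qed

text \<open>A block keeps the input order. If \<open>v d\<close> were outside the range,
  \<open>d\<close> would be inverted with one end, and the other end would then be between them in
  value but not in position.\<close>

lemma schedule_same_block:
  assumes sch: "schedule s t v I g" and inj: "inj_on v I" and I: "i \<in> I" "d \<in> I" "j \<in> I"
    and d: "i < d" "d < j" and "g i = g j" "v i < v j"
  shows "v i < v d" "v d < v j"
proof -
  have gd: "g i = g d" using schedule_mono[OF sch, of i d] schedule_mono[OF sch, of d j] assms by simp
  have ne: "v d \<noteq> v i" "v d \<noteq> v j" using inj I d by (auto dest: inj_onD)
  show "v i < v d"
  proof (rule ccontr)
    assume "\<not> v i < v d"
    then have "inverted v I g d j" using ne assms gd by (auto simp: inverted_def on_top_def)
    then show False using schedule_between(1)[OF sch, of d j i] \<open>\<not> v i < v d\<close> ne assms gd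
      by (auto simp: on_top_def)
  qed
  show "v d < v j"
  proof (rule ccontr)
    assume "\<not> v d < v j"
    then have "inverted v I g i d" using ne assms gd by (auto simp: inverted_def on_top_def)
    then show False using schedule_between(2)[OF sch, of i d j] \<open>\<not> v d < v j\<close> ne assms gd
      by (auto simp: on_top_def)
  qed
qed

text \<open>These are the right-to-left maxima relative to \<open>I\<close>; a right-to-left maximum
  of the whole permutation remains one in every \<open>I\<close> that contains it.\<close>

definition cuts_maxima :: "(nat \<Rightarrow> nat) \<Rightarrow> nat set \<Rightarrow> (nat \<Rightarrow> nat) \<Rightarrow> bool" where
  "cuts_maxima v I g \<longleftrightarrow>
     (\<forall>d\<in>I. \<forall>j\<in>I. d < j \<longrightarrow> (\<forall>k\<in>I. d < k \<longrightarrow> v k < v d) \<longrightarrow> g d < g j)"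

text \<open>Once a right-to-left maximum has been pushed, it and everything larger can be popped at once,
  so starting a new block after it costs nothing.\<close>

lemma schedule_cuts_maxima:
  assumes sch: "schedule s t v I g" and fin: "finite I" and inj: "inj_on v I"
  shows "\<exists>g'. schedule s t v I g' \<and> cuts_maxima v I g'"
proof -
  define D where "D = {d\<in>I. \<forall>k\<in>I. d < k \<longrightarrow> v k < v d}"
  \<comment> \<open>Adding the number of cuts before \<open>i\<close> refines the blocks exactly at
    the cuts and keeps their order.\<close>
  define c where "c i = card {d\<in>D. d < i}" for i
  define g' where "g' i = g i + c i" for i
  have finD: "finite D" using fin by (simp add: D_def)
  have cmono: "c i \<le> c j" if "i \<le> j" for i j
    unfolding c_def by (rule card_mono) (use finD that in auto)
  have cstrict: "c d < c j" if "d \<in> D" "d < j" for d j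
    unfolding c_def by (rule psubset_card_mono) (use finD that in auto)
  have cless: "\<exists>d\<in>D. i \<le> d \<and> d < j" if "c i < c j" for i j
  proof (rule ccontr)
    assume "\<not> ?thesis"
    then have "{d\<in>D. d < j} \<subseteq> {d\<in>D. d < i}" by (auto simp: not_le)
    then have "c j \<le> c i" unfolding c_def using finD by (intro card_mono) auto
    then show False using that by simp
  qed
  have gmono: "g i \<le> g j" if "i \<in> I" "j \<in> I" "i \<le> j" for i j
    using schedule_mono[OF sch] that by blast
  have g'mono: "g' i \<le> g' j" if "i \<in> I" "j \<in> I" "i \<le> j" for i j
    using gmono[OF that] cmono[OF that(3)] by (simp add: g'_def)
  have g'le: "g i \<le> g k" if "i \<in> I" "k \<in> I" "g' i \<le> g' k" for i k
  proof (cases "i \<le> k")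
    case True then show ?thesis using gmono that by blast
  next
    case False
    then show ?thesis using gmono[of k i] cmono[of k i] that by (simp add: g'_def)
  qed
  have g'eq: "g i = g j" if "i \<in> I" "j \<in> I" "g' i = g' j" for i j
    using g'le[of i j] g'le[of j i] that by simp
  \<comment> \<open>A cut between \<open>i\<close> and \<open>j\<close> would come from a value
    above \<open>v j\<close> inside a block with an ascent from \<open>i\<close> to
    \<open>j\<close>.\<close>
  have noD: "c i = c j" if ij: "i \<in> I" "j \<in> I" "i < j" "g i = g j" "v i < v j" for i j
  proof (rule ccontr)
    assume "c i \<noteq> c j"
    then have "c i < c j" using cmono[of i j] ij by simp
    then obtain d where d: "d \<in> D" "i \<le> d" "d < j" using cless by blast
    then have "v j < v d" "d \<in> I" using ij by (auto simp: D_def)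
    moreover from this have "i < d" using d ij by (cases "i = d") auto
    ultimately show False
      using schedule_same_block(2)[OF sch inj, of i d j] ij d by simp
  qed
  have lift: "on_top g' i j" if "i \<in> I" "j \<in> I" "on_top g i j" "v i < v j" for i j
  proof (cases "g i = g j")
    case True
    then show ?thesis using noD[of i j] that by (auto simp: on_top_def g'_def)
  next
    case False
    then have "g j < g i" using that by (auto simp: on_top_def)
    moreover from this have "j \<le> i" using gmono[of i j] that by (meson leD linorder_le_cases)
    ultimately show ?thesis using cmono[of j i] by (simp add: on_top_def g'_def)
  qed
  \<comment> \<open>No new inversion arises. The critical case is an old block with
    \<open>j < i\<close> and \<open>v i < v j\<close>, now separated by a maximum \<open>d\<close>.
    The value \<open>v k\<close> that retains \<open>j\<close> comes after \<open>d\<close> and so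
    is below \<open>v d\<close>; then \<open>j\<close> and \<open>d\<close> were already inverted,
    with \<open>v k\<close> in their range although \<open>k\<close> comes after
    \<open>d\<close>.\<close>
  have inv: "inverted v I g i j" if iv: "inverted v I g' i j" for i j
  proof -
    have ij: "i \<in> I" "j \<in> I" "on_top g' i j" "v i < v j"
      and meet: "g' i = g' j \<or> (\<exists>k\<in>I. g' i \<le> g' k \<and> v j < v k)"
      using iv by (auto simp: inverted_def)
    have "on_top g i j"
    proof (cases "g' i = g' j")
      case True then show ?thesis using ij g'eq[of i j] by (simp add: on_top_def)
    next
      case False
      then have lt: "g' j < g' i" using ij by (auto simp: on_top_def)
      then have "j < i" using g'mono[of i j] ij by (meson leD not_le_imp_less)
      show ?thesis
      proof (rule ccontr)
        assume "\<not> on_top g i j"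
        then have gij: "g i = g j" using gmono[of j i] ij \<open>j < i\<close> by (auto simp: on_top_def)
        then have "c j < c i" using lt by (simp add: g'_def)
        then obtain d where d: "d \<in> D" "j \<le> d" "d < i" using cless by blast
        then have dI: "d \<in> I" by (simp add: D_def)
        have gd: "g d = g j" using gmono[of j d] gmono[of d i] d dI ij gij by simp
        obtain k where k: "k \<in> I" "g' i \<le> g' k" "v j < v k" using meet False by blast
        have "g' d < g' i" using cstrict[OF d(1,3)] gd gij by (simp add: g'_def)
        then have "d < k" using k g'mono[of k d] dI by (meson leD le_less_trans not_le_imp_less less_le_trans)
        then have vkd: "v k < v d" using d k by (auto simp: D_def)
        then have "j < d" using k d by (cases "j = d") auto
        then have "inverted v I g j d" using gd ij dI k vkd by (auto simp: inverted_def on_top_def)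
        then show False
          using schedule_between[OF sch, of j d k] k vkd gd \<open>d < k\<close> by (auto simp: on_top_def)
      qed
    qed
    moreover have "g i = g j \<or> (\<exists>k\<in>I. g i \<le> g k \<and> v j < v k)"
      using meet g'eq[of i j] g'le[of i] ij by blast
    ultimately show ?thesis using ij by (simp add: inverted_def)
  qed
  have "schedule s t v I g'"
    unfolding schedule_def
  proof (intro conjI ballI allI impI)
    fix i j w assume a: "w \<in> I" "inverted v I g' i j" "v i < v w" "v w < v j"
    then have "i \<in> I" "j \<in> I" by (auto simp: inverted_def)
    then show "on_top g' i w" "on_top g' w j"
      using schedule_between[OF sch inv[OF a(2)]] a lift by auto
  next
    fix i j assume "inverted v I g' i j"
    then show "enat (card {w \<in> I. v i \<le> v w \<and> v w \<le> v j}) \<le> t" using schedule_run[OF sch] inv by blast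
  next
    fix x
    show "enat (card {i \<in> I. g' i = x}) \<le> s"
    proof (cases "\<exists>i\<in>I. g' i = x")
      case True
      then obtain i where i: "i \<in> I" "g' i = x" by blast
      have "{i \<in> I. g' i = x} \<subseteq> {j \<in> I. g j = g i}"
      proof
        fix j assume "j \<in> {i \<in> I. g' i = x}"
        then have "j \<in> I" "g' j = g' i" using i(2) by simp_all
        then show "j \<in> {j \<in> I. g j = g i}" using g'eq[of j i] i(1) by simp
      qed
      then have "card {i \<in> I. g' i = x} \<le> card {j \<in> I. g j = g i}"
        using fin by (intro card_mono) auto
      then show ?thesis using schedule_block[OF sch, of "g i"] by (meson enat_ord_simps(1) order_trans)
    next
      case False
      then have "{i \<in> I. g' i = x} = {}" by blast
      then show ?thesis by (metis card.empty i0_lb zero_enat_def)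
    qed
  qed (use g'mono in auto)
  moreover have "cuts_maxima v I g'"
    unfolding cuts_maxima_def
  proof (intro ballI impI)
    fix d j assume a: "d \<in> I" "j \<in> I" "d < j" "\<forall>k\<in>I. d < k \<longrightarrow> v k < v d"
    then have "d \<in> D" by (simp add: D_def)
    then show "g' d < g' j" using cstrict[of d j] gmono[of d j] a by (simp add: g'_def)
  qed
  ultimately show ?thesis by blast
qed

section \<open>Zones of a permutation and the runs inside them\<close>

locale perm_values =
  fixes n :: nat and v :: "nat \<Rightarrow> nat"
  assumes bij: "bij_betw v {..<n} {1..n}"
begin

lemma inj: "inj_on v {..<n}"
  using bij by (simp add: bij_betw_def)

lemma injD: "v i = v j \<Longrightarrow> i < n \<Longrightarrow> j < n \<Longrightarrow> i = j"
  using inj by (auto dest: inj_onD)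

lemma val_le: "i < n \<Longrightarrow> 1 \<le> v i \<and> v i \<le> n"
  using bij by (auto simp: bij_betw_def)

lemma position_of: "1 \<le> x \<Longrightarrow> x \<le> n \<Longrightarrow> \<exists>i<n. v i = x"
  using bij_betw_imp_surj_on[OF bij] by (metis atLeastAtMost_iff imageE lessThan_iff)

lemma position_between: "i < n \<Longrightarrow> j < n \<Longrightarrow> v i \<le> x \<Longrightarrow> x \<le> v j \<Longrightarrow> \<exists>k<n. v k = x"
  using position_of[of x] val_le[of i] val_le[of j] by simp

text \<open>No sorting can use a block across a hard boundary coming from an ascent, and by
  schedule_cuts_maxima none needs one across the other kind.\<close>

definition hard :: "nat \<Rightarrow> bool" where
  "hard i \<longleftrightarrow> v i < v (Suc i) \<and> v (Suc i) \<noteq> Suc (v i) \<or> (\<forall>k. i < k \<and> k < n \<longrightarrow> v k < v i)"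

definition zone :: "nat \<Rightarrow> nat" where
  "zone i = card {j. j < i \<and> hard j}"

lemma zone_mono: "i \<le> j \<Longrightarrow> zone i \<le> zone j"
  unfolding zone_def by (rule card_mono) auto

lemma zone_less: assumes "zone i < zone j" shows "\<exists>k. i \<le> k \<and> k < j \<and> hard k"
proof (rule ccontr)
  assume "\<not> ?thesis"
  then have "{k. k < j \<and> hard k} \<subseteq> {k. k < i \<and> hard k}" by (auto simp: not_le)
  then have "zone j \<le> zone i" unfolding zone_def by (intro card_mono) auto
  then show False using assms by simp
qed

lemma zone_less_imp: "zone i < zone j \<Longrightarrow> i < j"
  using zone_mono[of j i] by (meson leD not_le_imp_less)

lemma zone_eq_not_hard: assumes "zone i = zone j" "i \<le> k" "k < j" shows "\<not> hard k"
proof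
  assume "hard k"
  then have "zone k < zone (Suc k)" unfolding zone_def by (intro psubset_card_mono) auto
  moreover have "zone i \<le> zone k" "zone (Suc k) \<le> zone j" using assms(2,3) by (simp_all add: zone_mono)
  ultimately show False using assms by simp
qed

lemma zone_between: "zone i = zone j \<Longrightarrow> i \<le> k \<Longrightarrow> k \<le> j \<Longrightarrow> zone k = zone i"
  using zone_mono[of i k] zone_mono[of k j] by simp

text \<open>A discrete intermediate value argument: inside a zone every step rises by exactly one or
  falls. If the step into \<open>j\<close> falls, the value \<open>v j\<close> has already been used
  in the run from \<open>i\<close> to the position before \<open>j\<close>.\<close>

lemma zone_run_aux:
  assumes "j < n" "i \<le> j" "zone i = zone j" "v i \<le> v j"
  shows "v j = v i + (j - i)"
  using assms
proof (induction j arbitrary: i rule: less_induct)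
  case (less j)
  show ?case
  proof (cases "i = j")
    case False
    then have ij: "i < j" using less.prems by simp
    then obtain m where m: "j = Suc m" by (cases j) auto
    have im: "i \<le> m" "m < n" using ij m less.prems by auto
    have zm: "zone m = zone i" using zone_between[of i j m] less.prems m im by simp
    have run: "v k = v i + (k - i)" if k: "i \<le> k" "k \<le> m" and im': "v i \<le> v m" for k
    proof -
      have zk: "zone k = zone i" using zone_between[of i m k] zm k by simp
      have vm: "v m = v i + (m - i)" using less.IH[of m i] m im zm im' by simp
      have "v i \<le> v k"
      proof (rule ccontr)
        assume c: "\<not> v i \<le> v k"
        then have "v m = v k + (m - k)" using less.IH[of m k] m im zm zk k im' by simp
        then show False using vm c k by simp
      qed
      then show ?thesis using less.IH[of k i] m im k zk by simp
    qed
    have nh: "\<not> hard m" using zone_eq_not_hard[of i j m] less.prems m im by simp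
    have "v m \<noteq> v j" using injD[of m j] m im less.prems by auto
    then consider "v j = Suc (v m)" | "v j < v m" using nh m unfolding hard_def by fastforce
    then show ?thesis
    proof cases
      case 1
      have "v i \<noteq> v j" using injD[of i j] ij less.prems by auto
      then have "v i \<le> v m" using 1 less.prems by simp
      then show ?thesis using run[of m] 1 im m by simp
    next
      case 2
      then have le: "v i \<le> v m" using less.prems by simp
      define k where "k = i + (v j - v i)"
      have "v m = v i + (m - i)" using run[of m] le im by simp
      then have k: "i \<le> k" "k \<le> m" using 2 less.prems im by (auto simp: k_def)
      then have "v k = v j" using run[of k] le less.prems by (simp add: k_def)
      then show ?thesis using injD[of k j] k im m less.prems by simp
    qed
  qed simp
qed

lemma zone_run:
  assumes "j < n" "i \<le> k" "k \<le> j" "zone i = zone j" "v i \<le> v j"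
  shows "v k = v i + (k - i)"
proof -
  have zk: "zone k = zone i" using zone_between[of i j k] assms by simp
  have vj: "v j = v i + (j - i)" using zone_run_aux[of j i] assms by simp
  have "v i \<le> v k"
  proof (rule ccontr)
    assume c: "\<not> v i \<le> v k"
    then have "v j = v k + (j - k)" using zone_run_aux[of j k] assms zk by simp
    then show False using vj c assms by simp
  qed
  then show ?thesis using zone_run_aux[of k i] assms zk by simp
qed

lemma zone_run_position:
  assumes "j < n" "i \<le> j" "zone i = zone j" "k < n" "v i \<le> v k" "v k \<le> v j"
  shows "i \<le> k" "k \<le> j" "zone k = zone i"
proof -
  let ?k = "i + (v k - v i)"
  have vj: "v j = v i + (j - i)" using zone_run[of j i j] assms by simp
  then have kj: "i \<le> ?k" "?k \<le> j" using assms by auto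
  then have "v ?k = v k" using zone_run[of j i ?k] assms by simp
  then have "?k = k" using injD[of ?k k] kj assms by simp
  then show "i \<le> k" "k \<le> j" "zone k = zone i" using kj zone_between[of i j k] assms by auto
qed

text \<open>Being followed by an entry of its own zone, \<open>i\<close> is not a right-to-left
  maximum. The last entry that exceeds it is one; it ends a zone and therefore cannot come before
  \<open>j\<close>.\<close>

lemma zone_later_larger:
  assumes "i < j" "j < n" "zone i = zone j" "v j < v i"
  shows "\<exists>r>j. r < n \<and> v i < v r"
proof -
  let ?R = "{r. r < n \<and> i < r \<and> v i < v r}"
  have "\<not> hard i" using zone_eq_not_hard[of i j i] assms by simp
  then obtain k where "i < k" "k < n" "\<not> v k < v i" unfolding hard_def by blast
  moreover from this have "v k \<noteq> v i" using injD[of k i] assms by auto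
  ultimately have "k \<in> ?R" by simp
  then have r: "Max ?R \<in> ?R" by (intro Max_in) auto
  define r where "r = Max ?R"
  have last: "k \<le> r" if "k \<in> ?R" for k unfolding r_def by (rule Max_ge) (use that in auto)
  have "j < r"
  proof (rule ccontr)
    assume "\<not> j < r"
    then have "r < j" using r assms unfolding r_def[symmetric] by (cases "r = j") auto
    moreover have "v k < v r" if "r < k" "k < n" for k
      using last[of k] that r unfolding r_def[symmetric] by force
    then have "hard r" unfolding hard_def by blast
    ultimately show False using zone_eq_not_hard[of i j r] assms r unfolding r_def[symmetric] by simp
  qed
  then show ?thesis using r unfolding r_def[symmetric] by blast
qed

text \<open>When q is pushed, y is still on the stack in another block, so the values from v q to v y must
  end up as a run.\<close>

definition lands_on :: "nat \<Rightarrow> nat \<Rightarrow> bool" where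
  "lands_on q y \<longleftrightarrow> q < n \<and> zone y < zone q \<and> v q < v y \<and> (\<exists>r>q. r < n \<and> v y < v r)"

text \<open>By \<open>schedule_chain\<close> the pair \<open>q\<close>, \<open>y\<close> fixes the
  stacking order of all the values it spans. Only values and zone numbers occur here, so the order
  is known before any zone has been divided.\<close>

definition forced :: "nat \<Rightarrow> nat \<Rightarrow> bool" where
  "forced a b \<longleftrightarrow> v a < v b \<and> (\<exists>q y. lands_on q y \<and> v q \<le> v a \<and> v b \<le> v y)"

text \<open>Zones and forced pairs are those of the whole permutation, although \<open>A\<close>
  need not contain the entries that cause them.\<close>

definition faithful :: "enat \<Rightarrow> enat \<Rightarrow> nat set \<Rightarrow> (nat \<Rightarrow> nat) \<Rightarrow> bool" where
  "faithful s t A g \<longleftrightarrow> schedule s t v A g \<and>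
     (\<forall>a\<in>A. \<forall>b\<in>A. zone a < zone b \<longrightarrow> g a < g b) \<and>
     (\<forall>a\<in>A. \<forall>b\<in>A. forced a b \<longrightarrow> on_top g a b)"

text \<open>The quantifier over all supersets of \<open>Z\<close> allows certificates for different
  pairs to be united.\<close>

definition certifies :: "enat \<Rightarrow> enat \<Rightarrow> nat set \<Rightarrow> ((nat \<Rightarrow> nat) \<Rightarrow> bool) \<Rightarrow> bool" where
  "certifies s t Z R \<longleftrightarrow>
     (\<forall>W g. Z \<subseteq> W \<longrightarrow> W \<subseteq> {..<n} \<longrightarrow> schedule s t v W g \<longrightarrow> cuts_maxima v W g \<longrightarrow> R g)"

section \<open>Bounded certificates for cuts and forced pairs\<close>

lemma certifiesI:
  "(\<And>W g. Z \<subseteq> W \<Longrightarrow> W \<subseteq> {..<n} \<Longrightarrow> schedule s t v W g \<Longrightarrow> cuts_maxima v W g \<Longrightarrow> R g) \<Longrightarrow> certifies s t Z R"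
  by (simp add: certifies_def)

lemma certifiesD:
  "certifies s t Z R \<Longrightarrow> Z \<subseteq> W \<Longrightarrow> W \<subseteq> {..<n} \<Longrightarrow> schedule s t v W g \<Longrightarrow> cuts_maxima v W g \<Longrightarrow> R g"
  by (simp add: certifies_def)

text \<open>A cut after a right-to-left maximum \<open>k\<close> is witnessed by \<open>k\<close>
  alone. At an ascent by more than one, the entry \<open>u\<close> with the next value after
  \<open>v k\<close> would have to be stacked between \<open>k\<close> and \<open>Suc k\<close>,
  which inside one block means strictly between two adjacent positions.\<close>

lemma zone_less_witness:
  assumes ab: "a < n" "b < n" "zone a < zone b"
  shows "\<exists>Z\<subseteq>{..<n}. card Z \<le> 3 \<and> certifies s t ({a, b} \<union> Z) (\<lambda>g. g a < g b)"
proof -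
  obtain k where k: "a \<le> k" "k < b" "hard k" using zone_less[OF ab(3)] by blast
  show ?thesis
  proof (cases "\<forall>j. k < j \<and> j < n \<longrightarrow> v j < v k")
    case True
    have "certifies s t ({a, b} \<union> {k}) (\<lambda>g. g a < g b)"
    proof (rule certifiesI)
      fix W g assume W: "{a, b} \<union> {k} \<subseteq> W" "W \<subseteq> {..<n}" "schedule s t v W g" "cuts_maxima v W g"
      have "v j < v k" if "j \<in> W" "k < j" for j using True W(2) that by blast
      then have "g k < g b" using W(4)[unfolded cuts_maxima_def, rule_format, of k b] W(1) k(2) by simp
      then show "g a < g b" using schedule_mono[OF W(3), of a k] W(1) k by simp
    qed
    then show ?thesis using k ab by (intro exI[of _ "{k}"]) simp
  next
    case False
    then have as: "v k < v (Suc k)" "v (Suc k) \<noteq> Suc (v k)" using k unfolding hard_def by auto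
    then obtain u where u: "u < n" "v u = Suc (v k)"
      using position_between[of k "Suc k" "Suc (v k)"] k ab by auto
    have "certifies s t ({a, b} \<union> {k, Suc k, u}) (\<lambda>g. g a < g b)"
    proof (rule certifiesI)
      fix W g assume W: "{a, b} \<union> {k, Suc k, u} \<subseteq> W" "W \<subseteq> {..<n}" "schedule s t v W g"
      have "g k < g (Suc k)"
      proof (rule ccontr)
        assume "\<not> g k < g (Suc k)"
        then have eq: "g k = g (Suc k)" using schedule_mono[OF W(3), of k "Suc k"] W by simp
        then have "inverted v W g k (Suc k)" using W(1) as by (simp add: inverted_def on_top_def)
        then have "on_top g k u" "on_top g u (Suc k)"
          using schedule_between[OF W(3), of k "Suc k" u] W(1) u as by simp_all
        then show False using eq unfolding on_top_def by linarith
      qed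
      moreover have "g a \<le> g k" "g (Suc k) \<le> g b"
        using schedule_mono[OF W(3), of a k] schedule_mono[OF W(3), of "Suc k" b] W(1) k by simp_all
      ultimately show "g a < g b" by simp
    qed
    moreover have "card {k, Suc k, u} \<le> 3" by (simp add: card_insert_if)
    ultimately show ?thesis using k ab u by (intro exI[of _ "{k, Suc k, u}"]) simp
  qed
qed

text \<open>Once the cut between \<open>y\<close> and \<open>q\<close> is certified by three
  entries, the entries \<open>q\<close>, \<open>y\<close> and a later larger \<open>r\<close> form
  an inverted pair with the value that retains it; this gives six.\<close>

lemma forced_witness:
  assumes "forced a b"
  shows "\<exists>Z\<subseteq>{..<n}. card Z \<le> 6 \<and> certifies s t ({a, b} \<union> Z) (\<lambda>g. on_top g a b)"
proof -
  obtain q y where qy: "lands_on q y" "v q \<le> v a" "v b \<le> v y" and ab: "v a < v b"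
    using assms unfolding forced_def by blast
  then obtain r where q: "q < n" "zone y < zone q" "v q < v y" and r: "q < r" "r < n" "v y < v r"
    unfolding lands_on_def by blast
  have y: "y < q" using zone_less_imp q by blast
  then have yn: "y < n" using q by simp
  obtain Z where Z: "Z \<subseteq> {..<n}" "card Z \<le> 3" "certifies s t ({y, q} \<union> Z) (\<lambda>g. g y < g q)"
    using zone_less_witness[OF yn q(1,2), of s t] by blast
  have "certifies s t ({a, b} \<union> ({q, y, r} \<union> Z)) (\<lambda>g. on_top g a b)"
  proof (rule certifiesI)
    fix W g assume W: "{a, b} \<union> ({q, y, r} \<union> Z) \<subseteq> W" "W \<subseteq> {..<n}" "schedule s t v W g" "cuts_maxima v W g"
    have "g y < g q" by (rule certifiesD[OF Z(3) _ W(2-4)]) (use W(1) in simp)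
    moreover have "g q \<le> g r" using schedule_mono[OF W(3), of q r] W(1) r by simp
    moreover have "r \<in> W" using W(1) by simp
    ultimately have "inverted v W g q y"
      using W(1) q r unfolding inverted_def on_top_def by auto
    then show "on_top g a b"
      by (rule schedule_chain[OF W(3) inj_on_subset[OF inj W(2)]]) (use W(1) qy ab in simp_all)
  qed
  moreover have "card ({q, y, r} \<union> Z) \<le> 6"
  proof -
    have "card {q, y, r} \<le> 3" by (simp add: card_insert_if)
    then show ?thesis using card_Un_le[of "{q, y, r}" Z] Z(2) by linarith
  qed
  ultimately show ?thesis using Z(1) q r yn by (intro exI[of _ "{q, y, r} \<union> Z"]) simp
qed

text \<open>The factor 9 is 3 for a cut plus 6 for a forced order, spent on each ordered pair. The
  normalisation at maxima is done on the enlarged set, before restricting to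
  \<open>A\<close>.\<close>

lemma faithful_exists:
  assumes small: "\<And>W. W \<subseteq> {..<n} \<Longrightarrow> card W \<le> N \<Longrightarrow> \<exists>g. schedule s t v W g"
    and A: "A \<subseteq> {..<n}" "card A + 9 * (card A * card A) \<le> N"
  shows "\<exists>g. faithful s t A g"
proof -
  let ?R = "\<lambda>a b g. (zone a < zone b \<longrightarrow> g a < g b) \<and> (forced a b \<longrightarrow> on_top g a b)"
  have finA: "finite A" using A(1) finite_subset by blast
  let ?P = "\<lambda>a b Z. Z \<subseteq> {..<n} \<and> card Z \<le> 9 \<and> certifies s t ({a, b} \<union> Z) (?R a b)"
  have ex: "\<exists>Z. ?P a b Z" if "a \<in> A" "b \<in> A" for a b
  proof -
    have ab: "a < n" "b < n" using that A by auto
    have "\<exists>Z\<subseteq>{..<n}. card Z \<le> 3 \<and> certifies s t ({a, b} \<union> Z) (\<lambda>g. zone a < zone b \<longrightarrow> g a < g b)"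
    proof (cases "zone a < zone b")
      case True
      then show ?thesis using zone_less_witness[OF ab True, of s t] by simp
    qed (auto intro!: exI[of _ "{}"] certifiesI)
    then obtain Z1 where Z1: "Z1 \<subseteq> {..<n}" "card Z1 \<le> 3" "certifies s t ({a, b} \<union> Z1) (\<lambda>g. zone a < zone b \<longrightarrow> g a < g b)"
      by blast
    have "\<exists>Z\<subseteq>{..<n}. card Z \<le> 6 \<and> certifies s t ({a, b} \<union> Z) (\<lambda>g. forced a b \<longrightarrow> on_top g a b)"
    proof (cases "forced a b")
      case True
      then show ?thesis using forced_witness[OF True, of s t] by simp
    qed (auto intro!: exI[of _ "{}"] certifiesI)
    then obtain Z2 where Z2: "Z2 \<subseteq> {..<n}" "card Z2 \<le> 6" "certifies s t ({a, b} \<union> Z2) (\<lambda>g. forced a b \<longrightarrow> on_top g a b)"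
      by blast
    have "certifies s t ({a, b} \<union> (Z1 \<union> Z2)) (?R a b)"
    proof (rule certifiesI)
      fix W g assume W: "{a, b} \<union> (Z1 \<union> Z2) \<subseteq> W" "W \<subseteq> {..<n}" "schedule s t v W g" "cuts_maxima v W g"
      show "?R a b g"
        using certifiesD[OF Z1(3) _ W(2-4)] certifiesD[OF Z2(3) _ W(2-4)] W(1) by simp
    qed
    moreover have "card (Z1 \<union> Z2) \<le> 9" using card_Un_le[of Z1 Z2] Z1 Z2 by linarith
    ultimately show ?thesis using Z1(1) Z2(1) by (intro exI[of _ "Z1 \<union> Z2"]) simp
  qed
  define Z where "Z a b = (SOME Z. ?P a b Z)" for a b
  have Z: "Z a b \<subseteq> {..<n}" "card (Z a b) \<le> 9" "certifies s t ({a, b} \<union> Z a b) (?R a b)"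
    if "a \<in> A" "b \<in> A" for a b
    using someI_ex[OF ex[OF that]] unfolding Z_def by simp_all
  define C where "C = (\<Union>p\<in>A\<times>A. Z (fst p) (snd p))"
  define W where "W = A \<union> C"
  have "C \<subseteq> {..<n}" unfolding C_def by (rule UN_least, rule Z(1)) auto
  then have W: "W \<subseteq> {..<n}" using A(1) unfolding W_def by blast
  then have finW: "finite W" using finite_subset by blast
  have "card C \<le> (\<Sum>p\<in>A\<times>A. card (Z (fst p) (snd p)))"
    unfolding C_def by (rule card_UN_le) (use finA in simp)
  also have "\<dots> \<le> of_nat (card (A \<times> A)) * 9"
    by (rule sum_bounded_above) (use Z(2) in auto)
  finally have "card C \<le> 9 * (card A * card A)" by (simp add: card_cartesian_product)
  then have "card W \<le> N" using card_Un_le[of A C] A(2) unfolding W_def by linarith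
  then obtain g0 where "schedule s t v W g0" using small W by blast
  then obtain g where g: "schedule s t v W g" "cuts_maxima v W g"
    using schedule_cuts_maxima[OF _ finW inj_on_subset[OF inj W]] by blast
  have AW: "A \<subseteq> W" by (simp add: W_def)
  have "schedule s t v A (g \<circ> id)"
    by (rule schedule_embed[OF g(1) finW]) (use AW in auto)
  then have "schedule s t v A g" by simp
  moreover have "?R a b g" if ab: "a \<in> A" "b \<in> A" for a b
  proof (rule certifiesD[OF Z(3)[OF ab] _ W g])
    have "Z a b \<subseteq> C" unfolding C_def using ab by force
    then show "{a, b} \<union> Z a b \<subseteq> W" using ab unfolding W_def by blast
  qed
  ultimately show ?thesis unfolding faithful_def by (intro exI[of _ g]) simp
qed

end

section \<open>Choosing the blocks of a zone\<close>

text \<open>Every violation of a capacity is cut down to one element more than the capacity; this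
  keeps the samples bounded.\<close>

lemma subset_card_exceeding:
  assumes "\<not> enat (card V) \<le> s" "finite V"
  obtains a V' where "s = enat a" "V' \<subseteq> V" "card V' = Suc a" "finite V'"
proof -
  obtain a where a: "s = enat a" "a < card V" using assms(1) by (cases s) auto
  then obtain V' where "V' \<subseteq> V" "card V' = Suc a" using obtain_subset_with_card_n[of "Suc a" V] by auto
  then show thesis using that a assms(2) finite_subset by blast
qed

section \<open>Local conditions on one zone and the candidate divisions\<close>

context perm_values
begin

definition "members c = {i. i < n \<and> zone i = c}"

lemma finite_members: "finite (members c)"
  by (simp add: members_def)

lemma card_between:
  assumes "i < n" "j < n" "v i \<le> v j"
  shows "card {w. w < n \<and> v i \<le> v w \<and> v w \<le> v j} = Suc (v j - v i)"
proof -
  let ?S = "{w. w < n \<and> v i \<le> v w \<and> v w \<le> v j}"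
  have "v ` ?S = {v i..v j}"
  proof
    show "{v i..v j} \<subseteq> v ` ?S"
    proof
      fix x assume x: "x \<in> {v i..v j}"
      then obtain k where "k < n" "v k = x" using position_between[of i j x] assms by auto
      then show "x \<in> v ` ?S" using x by auto
    qed
  qed auto
  moreover have "inj_on v ?S" using inj by (rule inj_on_subset) auto
  ultimately have "card ?S = card {v i..v j}" using card_image[of v ?S] by simp
  then show ?thesis using assms by simp
qed

lemma forced_mono: "forced a b \<Longrightarrow> v a \<le> v i \<Longrightarrow> v i < v j \<Longrightarrow> v j \<le> v b \<Longrightarrow> forced i j"
  unfolding forced_def using order_trans[of _ "v a" "v i"] order_trans[of "v j" "v b"] by blast

lemma lands_on_less: "lands_on q y \<Longrightarrow> y < q \<and> y < n"
  unfolding lands_on_def using zone_less_imp[of y q] by simp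

text \<open>If \<open>v y\<close> falls inside the run from \<open>b\<close> to \<open>e\<close>,
  the same \<open>q\<close> also lands on \<open>e\<close>: the entry \<open>r\<close> follows
  \<open>q\<close>, hence belongs to a later zone than the run, so its value skips the run and
  exceeds \<open>v e\<close>.\<close>

lemma forced_extend_up:
  assumes f: "forced a b" and e: "b \<le> e" "e < n" "zone b = zone e" "v b \<le> v e"
  shows "forced a e"
proof -
  obtain q y where qy: "lands_on q y" "v q \<le> v a" "v b \<le> v y" and ab: "v a < v b"
    using f unfolding forced_def by blast
  then obtain r where r: "r > q" "r < n" "v y < v r" and q: "q < n" "zone y < zone q" "v q < v y"
    unfolding lands_on_def by blast
  show ?thesis
  proof (cases "v e \<le> v y")
    case True
    then show ?thesis using qy ab e unfolding forced_def by (meson less_le_trans)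
  next
    case False
    have y: "zone y = zone b"
      using zone_run_position(3)[of e b y] e qy(3) False lands_on_less[OF qy(1)] by simp
    have "v e < v r"
    proof (rule ccontr)
      assume "\<not> v e < v r"
      then have "zone r = zone b" using zone_run_position(3)[of e b r] e r qy(3) by simp
      then show False using zone_mono[of q r] r(1) q(2) y by simp
    qed
    then have "lands_on q e" using q r y e False unfolding lands_on_def by auto
    then show ?thesis using qy(2) ab e(4) unfolding forced_def by (meson less_le_trans order_refl)
  qed
qed

text \<open>If \<open>v q\<close> falls inside the run from \<open>d\<close> to \<open>a\<close>,
  then \<open>q\<close> is in the zone of \<open>d\<close> and not before it, so \<open>d\<close>
  lands on the same \<open>y\<close> with the same later entry \<open>r\<close>.\<close>

lemma forced_extend_down:
  assumes f: "forced a b" and d: "d \<le> a" "a < n" "zone d = zone a" "v d \<le> v a"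
  shows "forced d b"
proof -
  obtain q y where qy: "lands_on q y" "v q \<le> v a" "v b \<le> v y" and ab: "v a < v b"
    using f unfolding forced_def by blast
  then obtain r where r: "r > q" "r < n" "v y < v r" and q: "q < n" "zone y < zone q" "v q < v y"
    unfolding lands_on_def by blast
  show ?thesis
  proof (cases "v q \<le> v d")
    case True
    then show ?thesis using qy ab d unfolding forced_def by (meson le_less_trans)
  next
    case False
    have zq: "d \<le> q" "zone q = zone d"
      using zone_run_position[of a d q] d q(1) qy(2) False by simp_all
    then have "lands_on d y" using q r d False unfolding lands_on_def by (auto intro: exI[of _ r])
    then show ?thesis using qy(3) ab d(4) unfolding forced_def by (meson le_less_trans order_refl)
  qed
qed

text \<open>Conditions on a choice of blocks inside a single zone; they do not mention the choices made in
  the other zones.\<close>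

definition fits :: "enat \<Rightarrow> enat \<Rightarrow> nat \<Rightarrow> (nat \<Rightarrow> nat) \<Rightarrow> bool" where
  "fits s t c h \<longleftrightarrow>
     (\<forall>i\<in>members c. \<forall>j\<in>members c. i \<le> j \<longrightarrow> h i \<le> h j) \<and>
     (\<forall>a\<in>members c. \<forall>b\<in>members c. forced a b \<longrightarrow> on_top h a b) \<and>
     (\<forall>i\<in>members c. \<forall>j\<in>members c. j < i \<longrightarrow> v i < v j \<longrightarrow> h j < h i \<longrightarrow>
        enat (Suc (v j - v i)) \<le> t \<and>
        (\<forall>w<n. v i < v w \<longrightarrow> v w < v j \<longrightarrow> zone w = c \<and> on_top h i w \<and> on_top h w j)) \<and>
     (\<forall>i\<in>members c. \<forall>j\<in>members c. i < j \<longrightarrow> v i < v j \<longrightarrow> h i = h j \<longrightarrow> enat (Suc (v j - v i)) \<le> t) \<and>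
     (\<forall>x. enat (card {i\<in>members c. h i = x}) \<le> s)"

text \<open>A descent divided between two blocks always counts as inverted here, because
  \<open>zone_later_larger\<close> provides a larger entry still to come.\<close>

lemma fitsD:
  assumes "fits s t c h"
  shows "\<And>i j. i \<in> members c \<Longrightarrow> j \<in> members c \<Longrightarrow> i \<le> j \<Longrightarrow> h i \<le> h j"
    and "\<And>a b. a \<in> members c \<Longrightarrow> b \<in> members c \<Longrightarrow> forced a b \<Longrightarrow> on_top h a b"
    and "\<And>i j. i \<in> members c \<Longrightarrow> j \<in> members c \<Longrightarrow> j < i \<Longrightarrow> v i < v j \<Longrightarrow> h j < h i \<Longrightarrow> enat (Suc (v j - v i)) \<le> t"
    and "\<And>i j w. i \<in> members c \<Longrightarrow> j \<in> members c \<Longrightarrow> j < i \<Longrightarrow> v i < v j \<Longrightarrow> h j < h i \<Longrightarrow> w < n \<Longrightarrow>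
       v i < v w \<Longrightarrow> v w < v j \<Longrightarrow> zone w = c \<and> on_top h i w \<and> on_top h w j"
    and "\<And>i j. i \<in> members c \<Longrightarrow> j \<in> members c \<Longrightarrow> i < j \<Longrightarrow> v i < v j \<Longrightarrow> h i = h j \<Longrightarrow> enat (Suc (v j - v i)) \<le> t"
    and "\<And>x. enat (card {i\<in>members c. h i = x}) \<le> s"
  using assms unfolding fits_def by simp_all

text \<open>As a labelling this makes each run of a zone one block: inside a zone a new run starts
  exactly where the values fall.\<close>

definition drops :: "nat \<Rightarrow> nat" where
  "drops i = card {k. k < i \<and> v (Suc k) < v k}"

lemma drops_mono: "i \<le> j \<Longrightarrow> drops i \<le> drops j"
  unfolding drops_def by (rule card_mono) auto

lemma drops_run:
  assumes "i < j" "j < n" "zone i = zone j" "v i < v j"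
  shows "drops i = drops j"
proof -
  have "\<not> v (Suc k) < v k" if "i \<le> k" "k < j" for k
    using zone_run[of j i k] zone_run[of j i "Suc k"] assms that by simp
  then have "{k. k < i \<and> v (Suc k) < v k} = {k. k < j \<and> v (Suc k) < v k}"
    using assms(1) by (auto simp: not_le[symmetric])
  then show ?thesis by (simp add: drops_def)
qed

lemma drops_less:
  assumes "i < j" "j < n" "v j < v i"
  shows "drops i < drops j"
proof -
  have "\<exists>k. i \<le> k \<and> k < j \<and> v (Suc k) < v k"
  proof (rule ccontr)
    assume "\<not> ?thesis"
    then have up: "v k \<le> v (Suc k)" if "i \<le> k" "k < j" for k using that by (meson not_le)
    have "v i \<le> v j"
      using less_imp_le[OF assms(1)]
    proof (induction rule: dec_induct)
      case (step m) then show ?case using up[of m] by simp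
    qed simp
    then show False using assms by simp
  qed
  then obtain k where "i \<le> k" "k < j" "v (Suc k) < v k" by blast
  then have "k \<in> {k. k < j \<and> v (Suc k) < v k}" "k \<notin> {k. k < i \<and> v (Suc k) < v k}" by auto
  moreover have "{k. k < i \<and> v (Suc k) < v k} \<subseteq> {k. k < j \<and> v (Suc k) < v k}" using assms by auto
  ultimately show ?thesis unfolding drops_def by (intro psubset_card_mono) auto
qed

text \<open>Within a zone the runs descend in layers, so one block per run leaves the zone on the
  stack in sorted order, smallest on top. All demands on the order inside the zone are then
  met.\<close>

lemma drops_on_top:
  assumes "a < n" "b < n" "zone a = zone b" "v a < v b"
  shows "on_top drops a b"
proof (cases "a < b")
  case True then show ?thesis using drops_run[of a b] assms by (simp add: on_top_def)
next
  case False
  then have "b < a" using assms by (cases "a = b") auto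
  then show ?thesis using drops_less[of b a] assms by (simp add: on_top_def)
qed

lemma fits_drops:
  assumes closed: "\<And>i j w. i \<in> members c \<Longrightarrow> j \<in> members c \<Longrightarrow> w < n \<Longrightarrow> v i < v w \<Longrightarrow> v w < v j \<Longrightarrow> zone w = c"
    and len: "enat (card (members c)) \<le> t" and blocks: "\<And>x. enat (card {i\<in>members c. drops i = x}) \<le> s"
  shows "fits s t c drops"
proof -
  have run: "enat (Suc (v j - v i)) \<le> t" if "i \<in> members c" "j \<in> members c" "v i < v j" for i j
  proof -
    have ij: "i < n" "j < n" using that by (auto simp: members_def)
    have "{w. w < n \<and> v i \<le> v w \<and> v w \<le> v j} \<subseteq> members c"
    proof
      fix w assume w: "w \<in> {w. w < n \<and> v i \<le> v w \<and> v w \<le> v j}"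
      show "w \<in> members c"
      proof (cases "w = i \<or> w = j")
        case True then show ?thesis using that by blast
      next
        case False
        then have "v w \<noteq> v i" "v w \<noteq> v j" using injD[of w i] injD[of w j] w ij by auto
        then show ?thesis using closed[of i j w] that w by (simp add: members_def)
      qed
    qed
    then have "card {w. w < n \<and> v i \<le> v w \<and> v w \<le> v j} \<le> card (members c)"
      by (rule card_mono[OF finite_members])
    then have "enat (Suc (v j - v i)) \<le> enat (card (members c))"
      using card_between[OF ij] that(3) by simp
    then show ?thesis using len by (rule order_trans)
  qed
  have top: "on_top drops a b" if "a \<in> members c" "b \<in> members c" "v a < v b" for a b
    using drops_on_top[of a b] that by (simp add: members_def)
  show ?thesis
    unfolding fits_def
  proof (intro conjI ballI allI impI)
    fix a b assume "a \<in> members c" "b \<in> members c" "forced a b"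
    then show "on_top drops a b" using top[of a b] by (simp add: forced_def)
  next
    fix i j w assume a: "i \<in> members c" "j \<in> members c" "w < n" "v i < v w" "v w < v j"
    show z: "zone w = c" by (rule closed[OF a])
    then have "w \<in> members c" using a(3) by (simp add: members_def)
    then show "on_top drops i w" "on_top drops w j" using top a by simp_all
  qed (use drops_mono run blocks in simp_all)
qed

text \<open>In a single block the stacking order is the input order, so forced pairs must occur in
  that order and the inverted pairs are the ascents.\<close>

lemma fits_whole:
  assumes "\<And>a b. a \<in> members c \<Longrightarrow> b \<in> members c \<Longrightarrow> forced a b \<Longrightarrow> a < b"
    and "\<And>i j. i \<in> members c \<Longrightarrow> j \<in> members c \<Longrightarrow> i < j \<Longrightarrow> v i < v j \<Longrightarrow> enat (Suc (v j - v i)) \<le> t"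
    and "enat (card (members c)) \<le> s"
  shows "fits s t c (\<lambda>_. 0)"
proof -
  have "enat (card {i \<in> members c. (0::nat) = x}) \<le> s" for x
    using assms(3) by (cases "x = 0") (auto simp: zero_enat_def[symmetric])
  then show ?thesis using assms(1,2) by (simp add: fits_def on_top_def)
qed

text \<open>In an increasing zone pushed entry by entry, later and larger entries lie on top, so
  nothing is inverted.\<close>

lemma fits_singletons:
  assumes "\<And>a b. a \<in> members c \<Longrightarrow> b \<in> members c \<Longrightarrow> \<not> forced a b"
    and "\<And>i j. i \<in> members c \<Longrightarrow> j \<in> members c \<Longrightarrow> i < j \<Longrightarrow> v i < v j" and "1 \<le> s"
  shows "fits s t c id"
proof -
  have "enat (card {i \<in> members c. i = x}) \<le> s" for x
  proof -
    have "card {i \<in> members c. i = x} \<le> card {x}" by (rule card_mono) auto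
    then have "enat (card {i \<in> members c. i = x}) \<le> 1" by (simp add: one_enat_def)
    then show ?thesis using assms(3) by (rule order_trans)
  qed
  moreover have False if "i \<in> members c" "j \<in> members c" "j < i" "v i < v j" for i j
    using assms(2)[of j i] that by simp
  ultimately show ?thesis using assms(1) by (simp add: fits_def) blast
qed

text \<open>The positions \<open>x\<close> and \<open>y\<close> carry the smallest and the largest
  value of a zone that is not a single run. The larger entry \<open>r\<close> after the zone keeps
  all of it on the stack while it is being pushed, which makes every divided descent
  inverted.\<close>

definition extremes :: "nat \<Rightarrow> nat \<Rightarrow> nat \<Rightarrow> nat \<Rightarrow> bool" where
  "extremes c x y r \<longleftrightarrow> x \<in> members c \<and> y \<in> members c \<and> y < x \<and> r < n \<and> v y < v r \<and>
     (\<forall>w\<in>members c. v x \<le> v w \<and> v w \<le> v y \<and> w < r)"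

lemma extremes_exist:
  assumes i: "i \<in> members c" and j: "j \<in> members c" and "i < j" "v j < v i"
  shows "\<exists>x y r. extremes c x y r"
proof -
  have fin: "finite (v ` members c)" "v ` members c \<noteq> {}" using finite_members i by auto
  obtain y where y: "y \<in> members c" "v y = Max (v ` members c)" using Max_in[OF fin] by auto
  obtain x where x: "x \<in> members c" "v x = Min (v ` members c)" using Min_in[OF fin] by auto
  have le: "v x \<le> v w" "v w \<le> v y" if "w \<in> members c" for w
    using Max_ge[OF fin(1), of "v w"] Min_le[OF fin(1), of "v w"] that x y by simp_all
  have n: "x < n" "y < n" "i < n" "j < n" "zone x = c" "zone y = c" "zone i = c" "zone j = c"
    using x y i j by (auto simp: members_def)
  \<comment> \<open>If the minimum came before the maximum, the entire zone would be one run,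
    against the given descent.\<close>
  have yx: "y < x"
  proof (rule ccontr)
    assume "\<not> y < x"
    then have "x \<le> y" by simp
    then have p: "x \<le> i" "i \<le> y" "x \<le> j" "j \<le> y"
      using zone_run_position[of y x i] zone_run_position[of y x j] n le[OF i] le[OF j] by simp_all
    then have "v i = v x + (i - x)" "v j = v x + (j - x)"
      using zone_run[of y x i] zone_run[of y x j] n le[OF x(1)] by simp_all
    then show False using assms p by simp
  qed
  define l where "l = Max (members c)"
  have l: "l \<in> members c" unfolding l_def by (rule Max_in) (use finite_members i in auto)
  have last: "w \<le> l" if "w \<in> members c" for w unfolding l_def by (rule Max_ge[OF finite_members that])
  have yl: "y < l" using last[OF x(1)] yx by simp
  have ln: "l < n" "zone l = c" using l by (auto simp: members_def)
  have "v l \<noteq> v y" using injD[of l y] yl ln n by auto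
  then have "v l < v y" using le[OF l] by simp
  then obtain r where "r > l" "r < n" "v y < v r" using zone_later_larger[of y l] yl ln n by auto
  then have "extremes c x y r"
    unfolding extremes_def using x y yx le last by (auto intro: le_less_trans)
  then show ?thesis by blast
qed

end

text \<open>The bounds on \<open>K\<close> are generous: the samples used to refute a violated
  capacity take at most three times the larger finite capacity and a handful of further entries. An
  infinite capacity puts no demand on \<open>K\<close>.\<close>

locale locally_schedulable = perm_values +
  fixes s t :: enat and K :: nat
  assumes faith: "A \<subseteq> {..<n} \<Longrightarrow> card A \<le> K \<Longrightarrow> \<exists>g. faithful s t A g"
    and sK: "s = enat a \<Longrightarrow> 6 * a + 20 \<le> K" and tK: "t = enat b \<Longrightarrow> 6 * b + 20 \<le> K"
    and K20: "20 \<le> K" and s1: "1 \<le> s" and t1: "1 \<le> t"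
begin

section \<open>Counting in samples of bounded size\<close>

lemma inverted_few:
  assumes g: "faithful s t A g" and A: "finite A" and inv: "inverted v A g i j"
    and V: "V \<subseteq> A" "\<And>w. w \<in> V \<Longrightarrow> v i \<le> v w \<and> v w \<le> v j"
  shows "enat (card V) \<le> t"
proof -
  have "card V \<le> card {w\<in>A. v i \<le> v w \<and> v w \<le> v j}"
    by (rule card_mono) (use A V in auto)
  moreover have "schedule s t v A g" using g by (simp add: faithful_def)
  ultimately show ?thesis using schedule_run[OF _ inv] by (meson enat_ord_simps(1) order_trans)
qed

lemma same_few:
  assumes g: "faithful s t A g" and A: "finite A" and V: "V \<subseteq> A" "\<And>w. w \<in> V \<Longrightarrow> g w = x"
  shows "enat (card V) \<le> s"
proof -
  have "card V \<le> card {w\<in>A. g w = x}"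
    by (rule card_mono) (use A V in auto)
  moreover have "schedule s t v A g" using g by (simp add: faithful_def)
  ultimately show ?thesis using schedule_block[of s t v A g x] by (meson enat_ord_simps(1) order_trans)
qed

lemma faithful_mono: "faithful s t A g \<Longrightarrow> i \<in> A \<Longrightarrow> j \<in> A \<Longrightarrow> i \<le> j \<Longrightarrow> g i \<le> g j"
  using schedule_mono[of s t v A g i j] by (simp add: faithful_def)

lemma faithful_zone: "faithful s t A g \<Longrightarrow> i \<in> A \<Longrightarrow> j \<in> A \<Longrightarrow> zone i < zone j \<Longrightarrow> g i < g j"
  unfolding faithful_def by blast

lemma faithful_forced: "faithful s t A g \<Longrightarrow> i \<in> A \<Longrightarrow> j \<in> A \<Longrightarrow> forced i j \<Longrightarrow> on_top g i j"
  unfolding faithful_def by blast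

lemma faithful_between:
  "faithful s t A g \<Longrightarrow> inverted v A g i j \<Longrightarrow> w \<in> A \<Longrightarrow> v i < v w \<Longrightarrow> v w < v j \<Longrightarrow> on_top g i w \<and> on_top g w j"
  using schedule_between[of s t v A g i j w] by (simp add: faithful_def)

lemma faithful_chain:
  assumes "faithful s t A g" "A \<subseteq> {..<n}" "inverted v A g x y" "i \<in> A" "j \<in> A" "v x \<le> v i" "v i < v j" "v j \<le> v y"
  shows "on_top g i j"
  using assms(1) schedule_chain[OF _ inj_on_subset[OF inj assms(2)] assms(3-8), of s t] by (simp add: faithful_def)

text \<open>Labels never decrease along the positions, so where they never increase either they are
  constant and the set lies in one block.\<close>

lemma few_nonincreasing:
  assumes g: "faithful s t A g" and A: "finite A" and V: "V \<subseteq> A"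
    and noninc: "\<And>i j. i \<in> V \<Longrightarrow> j \<in> V \<Longrightarrow> i < j \<Longrightarrow> g j \<le> g i"
  shows "enat (card V) \<le> s"
proof (cases "V = {}")
  case True then show ?thesis by (simp add: zero_enat_def[symmetric])
next
  case False
  then obtain x where x: "x \<in> V" by blast
  have eq: "g i = g j" if "i \<in> V" "j \<in> V" "i < j" for i j
    using faithful_mono[OF g, of i j] noninc[OF that] that V by (simp add: subset_iff)
  have "g w = g x" if "w \<in> V" for w
    using linorder_less_linear[of w x] eq[OF that x] eq[OF x that] by metis
  then show ?thesis by (rule same_few[OF g A V])
qed

lemma forced_zones:
  assumes "forced a b" "a < n" "b < n" shows "zone b \<le> zone a"
proof (rule ccontr)
  assume "\<not> zone b \<le> zone a"
  moreover have "card {a, b} \<le> K" using K20 by (simp add: card_insert_if)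
  then obtain g where "faithful s t {a, b} g" using faith[of "{a, b}"] assms by auto
  ultimately have "g a < g b" "on_top g a b"
    using faithful_zone[of "{a, b}" g a b] faithful_forced[of "{a, b}" g a b] assms by auto
  then show False by (simp add: on_top_def)
qed

text \<open>Too long a range is refuted on a sample: one value more than the capacity from the
  range, together with \<open>q\<close>, \<open>y\<close> and the entry \<open>r\<close> that makes
  them inverted.\<close>

lemma lands_on_length:
  assumes "lands_on q y" shows "enat (Suc (v y - v q)) \<le> t"
proof (rule ccontr)
  assume c: "\<not> ?thesis"
  obtain r where r: "r > q" "r < n" "v y < v r" and q: "q < n" "zone y < zone q" "v q < v y"
    using assms unfolding lands_on_def by blast
  have y: "y < n" using lands_on_less[OF assms] by simp
  let ?V = "{w. w < n \<and> v q \<le> v w \<and> v w \<le> v y}"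
  have "\<not> enat (card ?V) \<le> t" using c card_between[of q y] q y by simp
  then obtain b V where V: "t = enat b" "V \<subseteq> ?V" "card V = Suc b" "finite V"
    by (rule subset_card_exceeding) auto
  let ?A = "V \<union> {q, y, r}"
  have "card ?A \<le> K"
    using card_Un_le[of V "{q, y, r}"] V(3) tK[OF V(1)] by (simp add: card_insert_if split: if_splits)
  moreover have A: "?A \<subseteq> {..<n}" using V q r y by auto
  ultimately obtain g where g: "faithful s t ?A g" using faith by blast
  have "g y < g q" using faithful_zone[OF g, of y q] q by simp
  moreover have "g q \<le> g r" using faithful_mono[OF g, of q r] r by simp
  ultimately have inv: "inverted v ?A g q y" using q r unfolding inverted_def on_top_def by auto
  have "enat (card V) \<le> t" by (rule inverted_few[OF g _ inv]) (use V in auto)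
  then show False using V by simp
qed

lemma forced_length:
  assumes "forced a b" shows "enat (Suc (v b - v a)) \<le> t"
proof -
  obtain q y where qy: "lands_on q y" "v q \<le> v a" "v b \<le> v y" using assms unfolding forced_def by blast
  have "enat (Suc (v b - v a)) \<le> enat (Suc (v y - v q))" using qy by simp
  then show ?thesis using lands_on_length[OF qy(1)] by (rule order_trans)
qed

text \<open>All or nothing: the extension lemmas spread one forced pair over the whole run, and a
  forced ascent has to share a block. So the run is either free of demands, and single entries do,
  or every pair is forced and the run must fit into one block.\<close>

lemma fits_run_zone:
  assumes inc: "\<And>i j. i \<in> members c \<Longrightarrow> j \<in> members c \<Longrightarrow> i < j \<Longrightarrow> v i < v j"
  shows "\<exists>h. fits s t c h"
proof (cases "\<exists>a\<in>members c. \<exists>b\<in>members c. forced a b")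
  case False
  then show ?thesis using fits_singletons[OF _ inc s1] by blast
next
  case True
  then obtain a b where ab: "a \<in> members c" "b \<in> members c" "forced a b" by blast
  have "v a < v b" using ab(3) by (simp add: forced_def)
  have inc': "v i \<le> v j" if "i \<in> members c" "j \<in> members c" "i \<le> j" for i j
    using inc[of i j] that by (cases "i = j") auto
  have all: "forced i j" if ij: "i \<in> members c" "j \<in> members c" "i < j" for i j
  proof -
    have d: "min i a \<in> members c" and e: "max j b \<in> members c" using ij ab by (auto simp: min_def max_def)
    have n: "a < n" "max j b < n" "zone a = c" "zone b = c" "zone (min i a) = c" "zone (max j b) = c"
      using d e ab by (auto simp: members_def)
    have "forced (min i a) b"
      by (rule forced_extend_down[OF ab(3)]) (use n inc'[OF d ab(1)] in auto)
    then have "forced (min i a) (max j b)"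
      by (rule forced_extend_up) (use n inc'[OF ab(2) e] in auto)
    then show ?thesis
      by (rule forced_mono) (use inc'[OF d ij(1)] inc'[OF ij(2) e] inc[OF ij] in auto)
  qed
  have "enat (card (members c)) \<le> s"
  proof (rule ccontr)
    assume "\<not> ?thesis"
    then obtain m V where V: "s = enat m" "V \<subseteq> members c" "card V = Suc m" "finite V"
      by (rule subset_card_exceeding[OF _ finite_members]) auto
    have Vn: "V \<subseteq> {..<n}" using V(2) by (auto simp: members_def)
    moreover have "card V \<le> K" using V(3) sK[OF V(1)] by simp
    ultimately obtain g where g: "faithful s t V g" using faith by blast
    have "enat (card V) \<le> s"
    proof (rule few_nonincreasing[OF g V(4)])
      fix i j assume "i \<in> V" "j \<in> V" "i < j"
      then show "g j \<le> g i" using faithful_forced[OF g, of i j] all[of i j] V(2) by (auto simp: on_top_def subset_iff)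
    qed simp
    then show False using V by simp
  qed
  moreover have "a < b" if "a \<in> members c" "b \<in> members c" "forced a b" for a b
  proof (rule ccontr)
    assume "\<not> a < b"
    then have "v b \<le> v a" using inc'[of b a] that by simp
    then show False using that(3) by (simp add: forced_def)
  qed
  ultimately show ?thesis using fits_whole[of c t s] forced_length[OF all] by blast
qed

section \<open>Zones with a descent\<close>

lemma extremesD:
  assumes "extremes c x y r"
  shows "x < n" "y < n" "zone x = c" "zone y = c" "x \<in> members c" "y \<in> members c" "y < x" "r < n" "v y < v r" "v x < v y"
    and "\<And>w. w \<in> members c \<Longrightarrow> v x \<le> v w \<and> v w \<le> v y \<and> w < r \<and> w < n \<and> zone w = c"
proof -
  show *: "x < n" "y < n" "zone x = c" "zone y = c" "x \<in> members c" "y \<in> members c" "y < x" "r < n" "v y < v r"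
    using assms by (auto simp: extremes_def members_def)
  show "\<And>w. w \<in> members c \<Longrightarrow> v x \<le> v w \<and> v w \<le> v y \<and> w < r \<and> w < n \<and> zone w = c"
    using assms by (auto simp: extremes_def members_def)
  have "v x \<le> v y" using assms * by (auto simp: extremes_def)
  moreover have "v x \<noteq> v y" using injD[of x y] * by auto
  ultimately show "v x < v y" by simp
qed

lemma inverted_drop:
  assumes g: "faithful s t A g" and ex: "extremes c x y r"
    and A: "r \<in> A" "i \<in> A" "j \<in> A" and M: "i \<in> members c" "j \<in> members c" and "v i < v j" "g j < g i"
  shows "inverted v A g i j"
proof -
  have "i \<le> r" "v j < v r" using extremesD(11)[OF ex M(1)] extremesD(11)[OF ex M(2)] extremesD(9)[OF ex] by auto
  moreover from this have "g i \<le> g r" using faithful_mono[OF g, of i r] A by simp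
  ultimately show ?thesis using assms unfolding inverted_def on_top_def by blast
qed

text \<open>With \<open>x\<close> inverted over \<open>y\<close> the sampled zone is stacked in
  sorted order. An ascent is sorted on the stack only if both entries share a block, so the sampled
  part of each run lies in one block.\<close>

lemma stacked_drops_few:
  assumes g: "faithful s t A g" and An: "A \<subseteq> {..<n}" and ex: "extremes c x y r" and inv: "inverted v A g x y"
    and V: "V \<subseteq> A" "V \<subseteq> {i \<in> members c. drops i = k}"
  shows "enat (card V) \<le> s"
proof (rule few_nonincreasing[OF g finite_subset[OF An finite_lessThan] V(1)])
  fix i j assume ij: "i \<in> V" "j \<in> V" "i < j"
  then have M: "i \<in> members c" "j \<in> members c" "drops i = drops j" using V(2) by auto
  have b: "v x \<le> v i" "v j \<le> v y" "i < n" "j < n" using extremesD(11)[OF ex M(1)] extremesD(11)[OF ex M(2)] by auto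
  have "v i \<noteq> v j" using injD[of i j] b ij by auto
  moreover have "\<not> v j < v i" using drops_less[of i j] ij b M by auto
  ultimately have "on_top g i j"
    using faithful_chain[OF g An inv, of i j] ij V b by auto
  then show "g j \<le> g i" by (auto simp: on_top_def)
qed

lemma stacked_few:
  assumes g: "faithful s t A g" and An: "A \<subseteq> {..<n}" and ex: "extremes c x y r" and inv: "inverted v A g x y"
    and V: "V \<subseteq> A" "V \<subseteq> members c"
  shows "enat (card V) \<le> t"
proof (rule inverted_few[OF g finite_subset[OF An finite_lessThan] inv V(1)])
  fix w assume "w \<in> V"
  then show "v x \<le> v w \<and> v w \<le> v y" using extremesD(11)[OF ex, of w] V by auto
qed

text \<open>A forced descent can be moved along the runs of its ends until it lies between
  \<open>y\<close> and \<open>x\<close> in position. Then \<open>y\<close> is pushed before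
  \<open>x\<close> in every faithful schedule that sees it, the zone is stacked in sorted order, and
  failure of one block per run would already show on a sample.\<close>

lemma fits_forced_drop:
  assumes ex: "extremes c x y r" and ab: "a \<in> members c" "b \<in> members c" and f: "forced a b" and ba: "b < a"
  shows "fits s t c drops"
proof -
  have n: "a < n" "b < n" "zone a = c" "zone b = c" "v x \<le> v a" "v b \<le> v y"
    using extremesD(11)[OF ex ab(1)] extremesD(11)[OF ex ab(2)] by auto
  have vab: "v a < v b" using f by (simp add: forced_def)
  note e = extremesD[OF ex]
  have "\<exists>b'\<in>members c. forced a b' \<and> y \<le> b' \<and> b' < a"
  proof (cases "y \<le> b")
    case True then show ?thesis using ab f ba by blast
  next
    case False
    have "forced a y" by (rule forced_extend_up[OF f]) (use False n e in auto)
    moreover have "y < a"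
    proof (rule ccontr)
      assume "\<not> y < a"
      then have "v a = v b + (a - b)" using zone_run[of y b a] n e ba by simp
      then show False using vab by simp
    qed
    ultimately show ?thesis using e by blast
  qed
  then obtain b' where b': "b' \<in> members c" "forced a b'" "y \<le> b'" "b' < a" by blast
  have "\<exists>a'\<in>members c. forced a' b' \<and> a' \<le> x \<and> b' < a'"
  proof (cases "a \<le> x")
    case True then show ?thesis using ab b' by blast
  next
    case False
    have "forced x b'" by (rule forced_extend_down[OF b'(2)]) (use False n e in auto)
    moreover have "b' < x"
    proof (rule ccontr)
      assume "\<not> b' < x"
      then have "v b' = v x + (b' - x)" "v a = v x + (a - x)"
        using zone_run[of a x b'] zone_run[of a x a] n e b' by simp_all
      moreover have "v a < v b'" using b' by (simp add: forced_def)
      ultimately show False using b' by simp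
    qed
    ultimately show ?thesis using e by blast
  qed
  then obtain a' where a': "a' \<in> members c" "forced a' b'" "a' \<le> x" "b' < a'" by blast
  have abn: "a' < n" "b' < n" using e(11)[OF a'(1)] e(11)[OF b'(1)] by auto
  \<comment> \<open>Any small set \<open>B\<close> of witnesses is sampled together with these five
    positions, whose presence makes \<open>x\<close> inverted over \<open>y\<close>.\<close>
  have key: "\<exists>A g. B \<subseteq> A \<and> x \<in> A \<and> y \<in> A \<and> A \<subseteq> {..<n} \<and> faithful s t A g \<and> inverted v A g x y"
    if B: "B \<subseteq> {..<n}" "card B + 5 \<le> K" for B
  proof -
    let ?A = "B \<union> {x, y, r, a', b'}"
    have "card {x, y, r, a', b'} \<le> 5" by (simp add: card_insert_if)
    then have "card ?A \<le> K" using card_Un_le[of B "{x, y, r, a', b'}"] B by linarith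
    moreover have A: "?A \<subseteq> {..<n}" using B e abn by auto
    ultimately obtain g where g: "faithful s t ?A g" using faith by blast
    have "on_top g a' b'" using faithful_forced[OF g _ _ a'(2)] by simp
    then have "g b' < g a'" using a'(4) by (auto simp: on_top_def)
    moreover have "g y \<le> g b'" "g a' \<le> g x"
      using faithful_mono[OF g, of y b'] faithful_mono[OF g, of a' x] a' b' by auto
    ultimately have "inverted v ?A g x y" using inverted_drop[OF g ex, of x y] e by simp
    moreover have "B \<subseteq> ?A" "x \<in> ?A" "y \<in> ?A" by auto
    ultimately show ?thesis using g A by blast
  qed
  show ?thesis
  proof (rule fits_drops)
    fix i j w assume w: "i \<in> members c" "j \<in> members c" "w < n" "v i < v w" "v w < v j"
    then have vw: "v x < v w" "v w < v y" using e(11)[OF w(1)] e(11)[OF w(2)] by auto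
    obtain A g where A: "{w} \<subseteq> A" "x \<in> A" "y \<in> A" and g: "faithful s t A g" and inv: "inverted v A g x y"
      using key[of "{w}"] w(3) K20 by auto
    have "on_top g x w \<and> on_top g w y" using faithful_between[OF g inv, of w] A vw by simp
    then have le: "g y \<le> g w" "g w \<le> g x" by (auto simp: on_top_def)
    have "\<not> zone w < zone y" using faithful_zone[OF g, of w y] A le by auto
    moreover have "\<not> zone x < zone w" using faithful_zone[OF g, of x w] A le by auto
    ultimately show "zone w = c" using e by simp
  next
    show "enat (card (members c)) \<le> t"
    proof (rule ccontr)
      assume "\<not> ?thesis"
      then obtain m V where V: "t = enat m" "V \<subseteq> members c" "card V = Suc m" "finite V"
        by (rule subset_card_exceeding[OF _ finite_members]) auto
      have Vn: "V \<subseteq> {..<n}" using V(2) by (auto simp: members_def)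
      obtain A g where A: "V \<subseteq> A" "A \<subseteq> {..<n}" and g: "faithful s t A g" and inv: "inverted v A g x y"
        using key[OF Vn] V(3) tK[OF V(1)] by auto
      have "enat (card V) \<le> t" by (rule stacked_few[OF g A(2) ex inv A(1) V(2)])
      then show False using V by simp
    qed
  next
    fix k
    show "enat (card {i \<in> members c. drops i = k}) \<le> s"
    proof (rule ccontr)
      assume "\<not> ?thesis"
      then obtain m V where V: "s = enat m" "V \<subseteq> {i \<in> members c. drops i = k}" "card V = Suc m" "finite V"
        by (rule subset_card_exceeding) (use finite_members in auto)
      have Vn: "V \<subseteq> {..<n}" using V(2) by (auto simp: members_def)
      obtain A g where A: "V \<subseteq> A" "A \<subseteq> {..<n}" and g: "faithful s t A g" and inv: "inverted v A g x y"
        using key[OF Vn] V(3) sK[OF V(1)] by auto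
      have "enat (card V) \<le> s" by (rule stacked_drops_few[OF g A(2) ex inv A(1) V(2)])
      then show False using V by simp
    qed
  qed
qed

lemma run_members:
  assumes "i \<in> members c" "j \<in> members c" "i < j" "v i < v j"
  shows "{w. w < n \<and> v i \<le> v w \<and> v w \<le> v j} \<subseteq> members c"
proof
  fix w assume "w \<in> {w. w < n \<and> v i \<le> v w \<and> v w \<le> v j}"
  then show "w \<in> members c" using zone_run_position(3)[of j i w] assms by (auto simp: members_def)
qed

text \<open>The foreign value \<open>v u\<close> lies below the first entry \<open>f\<close> of the
  zone and above the last entry \<open>l\<close>. If these were in different blocks,
  \<open>l\<close> would be inverted over \<open>f\<close> and \<open>u\<close> would have to be
  stacked between them, which its zone excludes. So the zone is forced into a single block.\<close>

lemma gap_zone: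
  assumes ex: "extremes c x y r" and u: "u < n" "zone u \<noteq> c" "v x < v u" "v u < v y"
  shows "enat (card (members c)) \<le> s"
    and "\<And>i j. i \<in> members c \<Longrightarrow> j \<in> members c \<Longrightarrow> i < j \<Longrightarrow> v i < v j \<Longrightarrow> enat (Suc (v j - v i)) \<le> t"
proof -
  note e = extremesD[OF ex]
  define f where "f = Min (members c)"
  define l where "l = Max (members c)"
  have ne: "members c \<noteq> {}" using e by blast
  have f: "f \<in> members c" unfolding f_def by (rule Min_in[OF finite_members ne])
  have l: "l \<in> members c" unfolding l_def by (rule Max_in[OF finite_members ne])
  have fl: "f \<le> w \<and> w \<le> l" if "w \<in> members c" for w
    unfolding f_def l_def using Min_le[OF finite_members that] Max_ge[OF finite_members that] by simp
  have fn: "f < n" "zone f = c" "l < n" "zone l = c" using e(11)[OF f] e(11)[OF l] by auto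
  \<comment> \<open>Otherwise \<open>u\<close> would lie in the run from \<open>f\<close> up to the
    maximum \<open>y\<close>, hence in the zone.\<close>
  have uf: "v u < v f"
  proof (rule ccontr)
    assume "\<not> v u < v f"
    then have "zone u = zone f" using zone_run_position(3)[of y f u] fl[OF e(6)] fn e u by simp
    then show False using u fn by simp
  qed
  have lu: "v l < v u"
  proof (rule ccontr)
    assume "\<not> v l < v u"
    then have "zone u = zone x" using zone_run_position(3)[of l x u] fl[OF e(5)] fn e u by simp
    then show False using u e by simp
  qed
  have key: "\<exists>A g. B \<subseteq> A \<and> A \<subseteq> {..<n} \<and> faithful s t A g \<and> (\<forall>w\<in>B. g w = g f)"
    if B: "B \<subseteq> members c" "card B + 4 \<le> K" for B
  proof -
    let ?A = "B \<union> {f, l, r, u}"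
    have "card {f, l, r, u} \<le> 4" by (simp add: card_insert_if)
    then have "card ?A \<le> K" using card_Un_le[of B "{f, l, r, u}"] B by linarith
    moreover have A: "?A \<subseteq> {..<n}" using B e(8) fn u by (auto simp: members_def)
    ultimately obtain g where g: "faithful s t ?A g" using faith by blast
    have "g l \<le> g f"
    proof (rule ccontr)
      assume "\<not> g l \<le> g f"
      then have "inverted v ?A g l f" using inverted_drop[OF g ex, of l f] f l uf lu by simp
      then have "on_top g l u \<and> on_top g u f" using faithful_between[OF g, of l f u] uf lu by simp
      then have le: "g f \<le> g u" "g u \<le> g l" by (auto simp: on_top_def)
      have "\<not> zone u < zone f" using faithful_zone[OF g, of u f] le by auto
      moreover have "\<not> zone l < zone u" using faithful_zone[OF g, of l u] le by auto
      ultimately show False using u fn by simp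
    qed
    then have "g w = g f" if "w \<in> B" for w
      using faithful_mono[OF g, of f w] faithful_mono[OF g, of w l] fl[of w] that B(1) by (auto simp: subset_iff)
    moreover have "B \<subseteq> ?A" by auto
    ultimately show ?thesis using g A by blast
  qed
  show "enat (card (members c)) \<le> s"
  proof (rule ccontr)
    assume "\<not> ?thesis"
    then obtain m V where V: "s = enat m" "V \<subseteq> members c" "card V = Suc m" "finite V"
      by (rule subset_card_exceeding[OF _ finite_members]) auto
    obtain A g where A: "V \<subseteq> A" "A \<subseteq> {..<n}" and g: "faithful s t A g" and c: "\<And>w. w \<in> V \<Longrightarrow> g w = g f"
      using key[OF V(2)] V(3) sK[OF V(1)] by auto
    have "enat (card V) \<le> s" by (rule same_few[OF g finite_subset[OF A(2) finite_lessThan] A(1) c])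
    then show False using V by simp
  qed
  fix i j assume ij: "i \<in> members c" "j \<in> members c" "i < j" "v i < v j"
  show "enat (Suc (v j - v i)) \<le> t"
  proof (rule ccontr)
    assume "\<not> ?thesis"
    then have "\<not> enat (card {w. w < n \<and> v i \<le> v w \<and> v w \<le> v j}) \<le> t"
      using card_between[of i j] e(11)[OF ij(1)] e(11)[OF ij(2)] ij by simp
    then obtain m V where V: "t = enat m" "V \<subseteq> {w. w < n \<and> v i \<le> v w \<and> v w \<le> v j}" "card V = Suc m" "finite V"
      by (rule subset_card_exceeding) auto
    have VM: "V \<union> {i, j} \<subseteq> members c" using V(2) run_members[OF ij] ij by blast
    have "card (V \<union> {i, j}) + 4 \<le> K"
      using card_Un_le[of V "{i, j}"] V(3) tK[OF V(1)] by (simp add: card_insert_if split: if_splits)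
    then obtain A g where A: "V \<union> {i, j} \<subseteq> A" "A \<subseteq> {..<n}" and g: "faithful s t A g"
      and c: "\<And>w. w \<in> V \<union> {i, j} \<Longrightarrow> g w = g f"
      using key[OF VM] by blast
    have "g i = g j" using c[of i] c[of j] by simp
    then have inv: "inverted v A g i j" using A ij by (auto simp: inverted_def on_top_def)
    have "enat (card V) \<le> t"
      by (rule inverted_few[OF g finite_subset[OF A(2) finite_lessThan] inv]) (use A V in auto)
    then show False using V by simp
  qed
qed

text \<open>The division is copied from a faithful schedule of the zone with \<open>r\<close> added.
  As no foreign value lies between \<open>v x\<close> and \<open>v y\<close>, the sampled value
  ranges are complete and their sizes are the true ones.\<close>

lemma fits_small_zone:
  assumes ex: "extremes c x y r" and closed: "\<And>w. w < n \<Longrightarrow> v x < v w \<Longrightarrow> v w < v y \<Longrightarrow> zone w = c"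
    and small: "card (members c) < K"
  shows "\<exists>h. fits s t c h"
proof -
  note e = extremesD[OF ex]
  let ?A = "insert r (members c)"
  have An: "?A \<subseteq> {..<n}" using e(8) by (auto simp: members_def)
  have finA: "finite ?A" by (simp add: finite_members)
  have "card ?A \<le> K" using small by (simp add: card_insert_if finite_members)
  then obtain g where g: "faithful s t ?A g" using faith An by blast
  have cl: "w \<in> members c" if "i \<in> members c" "j \<in> members c" "w < n" "v i \<le> v w" "v w \<le> v j" for i j w
  proof (cases "v w = v x \<or> v w = v y")
    case True
    then have "w = x \<or> w = y" using injD[of w x] injD[of w y] that(3) e(1,2) by auto
    then show ?thesis using e(5,6) by blast
  next
    case False
    then have "v x < v w" "v w < v y" using e(11)[OF that(1)] e(11)[OF that(2)] that by auto
    then show ?thesis using closed[of w] that by (simp add: members_def)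
  qed
  have len: "enat (Suc (v j - v i)) \<le> t" if "i \<in> members c" "j \<in> members c" "inverted v ?A g i j" for i j
  proof -
    have "enat (card {w. w < n \<and> v i \<le> v w \<and> v w \<le> v j}) \<le> t"
      by (rule inverted_few[OF g finA that(3)]) (use cl[OF that(1,2)] in auto)
    then show ?thesis using card_between[of i j] e(11)[OF that(1)] e(11)[OF that(2)] that(3) by (simp add: inverted_def)
  qed
  have "fits s t c g"
    unfolding fits_def
  proof (intro conjI ballI allI impI)
    fix i j assume "i \<in> members c" "j \<in> members c" "i \<le> j"
    then show "g i \<le> g j" using faithful_mono[OF g, of i j] by simp
  next
    fix a b assume "a \<in> members c" "b \<in> members c" "forced a b"
    then show "on_top g a b" using faithful_forced[OF g, of a b] by simp
  next
    fix i j assume a: "i \<in> members c" "j \<in> members c" "v i < v j" "g j < g i"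
    have inv: "inverted v ?A g i j" using inverted_drop[OF g ex, of i j] a by simp
    show "enat (Suc (v j - v i)) \<le> t" by (rule len[OF a(1,2) inv])
    fix w assume w: "w < n" "v i < v w" "v w < v j"
    have M: "w \<in> members c" using cl[OF a(1,2) w(1)] w by simp
    then show "zone w = c" by (simp add: members_def)
    show "on_top g i w" "on_top g w j" using faithful_between[OF g inv, of w] M w by auto
  next
    fix i j assume a: "i \<in> members c" "j \<in> members c" "i < j" "v i < v j" "g i = g j"
    then show "enat (Suc (v j - v i)) \<le> t" by (intro len) (auto simp: inverted_def on_top_def)
  next
    fix k
    show "enat (card {i \<in> members c. g i = k}) \<le> s" by (rule same_few[OF g finA, of _ k]) auto
  qed
  then show ?thesis by blast
qed

text \<open>If the first and the last run of a zone are joined by a block, then at most one further block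
  can occur in the zone, and only at one of its two ends.\<close>

context
  fixes A g c x y r
  assumes g: "faithful s t A g" and An: "A \<subseteq> {..<n}" and ex: "extremes c x y r"
    and xA: "x \<in> A" and yA: "y \<in> A" and rA: "r \<in> A" and joined: "g y = g x"
begin

lemma early_block:
  assumes e: "e \<in> A" "e \<in> members c" "g e < g x"
  shows "inverted v A g x e" "e < y"
proof -
  note ex' = extremesD[OF ex]
  have "e \<noteq> x" using e by auto
  then have "v x \<noteq> v e" using injD[of x e] ex'(1) ex'(11)[OF e(2)] by auto
  then have "v x < v e" using ex'(11)[OF e(2)] by simp
  then show "inverted v A g x e" using inverted_drop[OF g ex rA xA e(1) ex'(5) e(2)] e(3) by simp
  show "e < y"
  proof (rule ccontr)
    assume "\<not> e < y"
    then show False using faithful_mono[OF g yA e(1)] joined e(3) by simp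
  qed
qed

lemma late_block:
  assumes e: "e \<in> A" "e \<in> members c" "g x < g e"
  shows "inverted v A g e y" "x < e"
proof -
  note ex' = extremesD[OF ex]
  have "e \<noteq> y" using e joined by auto
  then have "v y \<noteq> v e" using injD[of y e] ex'(2) ex'(11)[OF e(2)] by auto
  then have "v e < v y" using ex'(11)[OF e(2)] by simp
  then show "inverted v A g e y" using inverted_drop[OF g ex rA e(1) yA e(2) ex'(6)] e(3) joined by simp
  show "x < e"
  proof (rule ccontr)
    assume "\<not> x < e"
    then show False using faithful_mono[OF g e(1) xA] e(3) by simp
  qed
qed

text \<open>If \<open>v e' \<le> v e\<close>, then \<open>e'\<close> over \<open>y\<close> is an
  inverted pair spanning \<open>v e\<close>, which would place \<open>e\<close> above
  \<open>y\<close>. Otherwise the run from \<open>e\<close> to \<open>e'\<close> passes through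
  \<open>y\<close>, so \<open>v y < v e'\<close>.\<close>

lemma early_or_late:
  assumes e: "e \<in> A" "e \<in> members c" "g e < g x" and e': "e' \<in> A" "e' \<in> members c" "g x < g e'"
  shows False
proof -
  note ex' = extremesD[OF ex]
  have n: "e < n" "e' < n" "zone e = c" "zone e' = c" using ex'(11)[OF e(2)] ex'(11)[OF e'(2)] by auto
  have pos: "e < y" "y < e'" using early_block(2)[OF e] late_block(2)[OF e'] ex'(7) by auto
  have vy: "v e' < v y" using late_block(1)[OF e'] by (simp add: inverted_def)
  show False
  proof (cases "v e' \<le> v e")
    case True
    have "v e \<noteq> v y" using injD[of e y] n ex'(2) pos by auto
    then have "v e < v y" using ex'(11)[OF e(2)] by simp
    then have "on_top g e y" using faithful_chain[OF g An late_block(1)[OF e'] e(1) yA True] by simp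
    then show False using joined e(3) by (simp add: on_top_def)
  next
    case False
    then have "v y = v e + (y - e)" "v e' = v e + (e' - e)"
      using zone_run[of e' e y] zone_run[of e' e e'] n pos by simp_all
    then show False using vy pos by simp
  qed
qed

text \<open>Early entries belong to the run that leads up to \<open>y\<close>, so they ascend; lying
  inverted under \<open>x\<close> they are stacked in sorted order, and an ascent can be so only
  within one block. The late entries behave in the same way on the run that starts at
  \<open>x\<close>.\<close>

lemma early_eq:
  assumes e: "e \<in> A" "e \<in> members c" "g e < g x" and e': "e' \<in> A" "e' \<in> members c" "g e' < g x" and "e < e'"
  shows "g e = g e'"
proof -
  note ex' = extremesD[OF ex]
  have n: "e < n" "e' < n" "zone e = c" "zone e' = c" using ex'(11)[OF e(2)] ex'(11)[OF e'(2)] by auto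
  have "v e' = v e + (e' - e)"
    using zone_run[of y e e'] early_block(2)[OF e'] \<open>e < e'\<close> ex'(2,4) ex'(11)[OF e(2)] n by simp
  then have "on_top g e e'"
    using faithful_chain[OF g An early_block(1)[OF e'] e(1) e'(1)] ex'(11)[OF e(2)] \<open>e < e'\<close> by simp
  then show ?thesis using faithful_mono[OF g e(1) e'(1)] \<open>e < e'\<close> by (auto simp: on_top_def)
qed

lemma late_eq:
  assumes e: "e \<in> A" "e \<in> members c" "g x < g e" and e': "e' \<in> A" "e' \<in> members c" "g x < g e'" and "e < e'"
  shows "g e = g e'"
proof -
  note ex' = extremesD[OF ex]
  have n: "e < n" "e' < n" "zone e = c" "zone e' = c" using ex'(11)[OF e(2)] ex'(11)[OF e'(2)] by auto
  have "v e = v x + (e - x)" "v e' = v x + (e' - x)"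
    using zone_run[of e' x e] zone_run[of e' x e'] late_block(2)[OF e] \<open>e < e'\<close> ex'(3) ex'(11)[OF e'(2)] n by simp_all
  then have "v e < v e'" using late_block(2)[OF e] \<open>e < e'\<close> by simp
  then have "on_top g e e'"
    using faithful_chain[OF g An late_block(1)[OF e] e(1) e'(1)] ex'(11)[OF e'(2)] by simp
  then show ?thesis using faithful_mono[OF g e(1) e'(1)] \<open>e < e'\<close> by (auto simp: on_top_def)
qed

lemma joined_two_labels:
  assumes V: "V \<subseteq> A" "V \<subseteq> members c"
  shows "\<exists>p. \<forall>w\<in>V. g w = p \<or> g w = g x"
proof -
  have V': "w \<in> A" "w \<in> members c" if "w \<in> V" for w using V that by auto
  consider e where "e \<in> V" "g e < g x" | e where "e \<in> V" "g x < g e" | "\<forall>w\<in>V. g w = g x"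
    by (meson nat_neq_iff)
  then show ?thesis
  proof cases
    case (1 e)
    have "g w = g e \<or> g w = g x" if "w \<in> V" for w
      using early_or_late[OF V'[OF 1(1)] 1(2) V'[OF that]] early_eq[OF V'[OF 1(1)] 1(2) V'[OF that]]
        early_eq[OF V'[OF that] _ V'[OF 1(1)] 1(2)] by (metis nat_neq_iff)
    then show ?thesis by blast
  next
    case (2 e)
    have "g w = g e \<or> g w = g x" if "w \<in> V" for w
      using early_or_late[OF V'[OF that] _ V'[OF 2(1)] 2(2)] late_eq[OF V'[OF 2(1)] 2(2) V'[OF that]]
        late_eq[OF V'[OF that] _ V'[OF 2(1)] 2(2)] by (metis nat_neq_iff)
    then show ?thesis by blast
  qed blast
qed

lemma joined_card_le_push:
  assumes V: "V \<subseteq> A" "V \<subseteq> members c" and s: "s = enat a"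
  shows "card V \<le> 2 * a"
proof -
  have finA: "finite A" using An finite_subset by blast
  obtain p where p: "\<forall>w\<in>V. g w = p \<or> g w = g x" using joined_two_labels[OF V] by blast
  have "enat (card {w\<in>V. g w = q}) \<le> s" for q
    by (rule same_few[OF g finA, of _ q]) (use V in auto)
  then have "card {w\<in>V. g w = q} \<le> a" for q using s by simp
  from this[of p] this[of "g x"] have "card {w\<in>V. g w = p} + card {w\<in>V. g w = g x} \<le> 2 * a" by simp
  moreover have "V = {w\<in>V. g w = p} \<union> {w\<in>V. g w = g x}" using p by blast
  ultimately show ?thesis using card_Un_le[of "{w\<in>V. g w = p}" "{w\<in>V. g w = g x}"] by simp
qed

text \<open>A second label splits \<open>V\<close> into two value ranges, each taken by one pop. In
  the early case \<open>x\<close> is inverted over the largest early entry \<open>e\<close>, which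
  accounts for the values up to \<open>v e\<close>; the larger ones are in the common block, and
  their smallest entry lies on the run leading up to \<open>y\<close> and is inverted with
  \<open>y\<close>. The late case is the mirror image.\<close>

lemma joined_card_le_pop:
  assumes V: "V \<subseteq> A" "V \<subseteq> members c" and t: "t = enat b" and diff: "e0 \<in> V" "g e0 \<noteq> g x"
  shows "card V \<le> 2 * b"
proof -
  note ex' = extremesD[OF ex]
  have finA: "finite A" using An finite_subset by blast
  have finV: "finite V" using V(1) finA finite_subset by blast
  have V': "w \<in> A" "w \<in> members c" if "w \<in> V" for w using V that by auto
  \<comment> \<open>For a range that shrinks to a single entry, where there is no inverted pair to
    bound it.\<close>
  have b1: "1 \<le> b" using t1 t by (simp add: one_enat_def)
  have few: "card B \<le> b" if "inverted v A g i j" "B \<subseteq> V" "\<And>w. w \<in> B \<Longrightarrow> v i \<le> v w \<and> v w \<le> v j" for i j B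
    using inverted_few[OF g finA that(1), of B] that V(1) t by auto
  have sing: "card B \<le> b" if "\<And>w. w \<in> B \<Longrightarrow> w = k" for B and k :: nat
  proof -
    have "B \<subseteq> {k}" using that by blast
    then have "card B \<le> card {k}" by (rule card_mono[rotated]) simp
    then show ?thesis using b1 by simp
  qed
  have split: "card V \<le> 2 * b" if "V = B \<union> C" "card B \<le> b" "card C \<le> b" for B C
    using card_Un_le[of B C] that by simp
  consider "g e0 < g x" | "g x < g e0" using diff by linarith
  then show ?thesis
  proof cases
    case 1
    let ?E = "{e\<in>V. g e < g x}"
    have "finite (v ` ?E)" "v ` ?E \<noteq> {}" using finV diff 1 by auto
    from Max_in[OF this] obtain e where e: "e \<in> ?E" "v e = Max (v ` ?E)" by auto
    have emax: "v w \<le> v e" if "w \<in> V" "g w < g x" for w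
      unfolding e(2) by (rule Max_ge) (use finV that in auto)
    have eV: "e \<in> V" "g e < g x" using e(1) by auto
    have en: "e < n" "zone e = c" "v e \<le> v y" using ex'(11)[OF V'(2)[OF eV(1)]] by auto
    let ?B = "{w\<in>V. v w \<le> v e}" and ?C = "{w\<in>V. v e < v w}"
    have B: "card ?B \<le> b"
      by (rule few[OF early_block(1)[OF V'[OF eV(1)] eV(2)]]) (use ex'(11) V' in auto)
    have gC: "g w = g x" if "w \<in> ?C" for w
      using emax[of w] early_or_late[OF V'[OF eV(1)] eV(2) V'[of w]] that by (cases "g w" "g x" rule: linorder_cases) auto
    have C: "card ?C \<le> b"
    proof (cases "?C = {}")
      case False
      then have "finite (v ` ?C)" "v ` ?C \<noteq> {}" using finV by auto
      from Min_in[OF this] obtain f where f: "f \<in> ?C" "v f = Min (v ` ?C)" by auto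
      have fmin: "v f \<le> v w" if "w \<in> ?C" for w unfolding f(2) by (rule Min_le) (use finV that in auto)
      have fV: "f \<in> V" "v e < v f" using f(1) by auto
      have fn: "f < n" "zone f = c" "v f \<le> v y" using ex'(11)[OF V'(2)[OF fV(1)]] by auto
      have Cy: "v w \<le> v y" "w < n" if "w \<in> ?C" for w using ex'(11)[OF V'(2), of w] that by auto
      show ?thesis
      proof (cases "f = y")
        case True
        have "w = y" if "w \<in> ?C" for w
          using fmin[OF that] Cy[OF that] True injD[of w y] ex'(2) by simp
        then show ?thesis by (rule sing)
      next
        case False
        then have "v f \<noteq> v y" using injD[of f y] fn ex'(2) by auto
        then have "v f < v y" using fn by simp
        moreover have "f \<le> y"
          using zone_run_position(2)[of y e f] ex'(2,4) en fn fV early_block(2)[OF V'[OF eV(1)] eV(2)] by simp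
        ultimately have "inverted v A g f y"
          using False V'[OF fV(1)] yA gC[OF f(1)] joined unfolding inverted_def on_top_def by auto
        then show ?thesis by (rule few) (use fmin Cy in auto)
      qed
    next
      case True
      then show ?thesis by (metis card.empty zero_le)
    qed
    show ?thesis by (rule split[OF _ B C]) auto
  next
    case 2
    let ?E = "{e\<in>V. g x < g e}"
    have "finite (v ` ?E)" "v ` ?E \<noteq> {}" using finV diff 2 by auto
    from Min_in[OF this] obtain e where e: "e \<in> ?E" "v e = Min (v ` ?E)" by auto
    have emin: "v e \<le> v w" if "w \<in> V" "g x < g w" for w
      unfolding e(2) by (rule Min_le) (use finV that in auto)
    have eV: "e \<in> V" "g x < g e" using e(1) by auto
    have en: "e < n" "zone e = c" "v x \<le> v e" using ex'(11)[OF V'(2)[OF eV(1)]] by auto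
    let ?B = "{w\<in>V. v e \<le> v w}" and ?C = "{w\<in>V. v w < v e}"
    have B: "card ?B \<le> b"
      by (rule few[OF late_block(1)[OF V'[OF eV(1)] eV(2)]]) (use ex'(11) V' in auto)
    have gC: "g w = g x" if "w \<in> ?C" for w
      using emin[of w] early_or_late[OF V'[of w] _ V'[OF eV(1)] eV(2)] that by (cases "g w" "g x" rule: linorder_cases) auto
    have C: "card ?C \<le> b"
    proof (cases "?C = {}")
      case False
      then have "finite (v ` ?C)" "v ` ?C \<noteq> {}" using finV by auto
      from Max_in[OF this] obtain f where f: "f \<in> ?C" "v f = Max (v ` ?C)" by auto
      have fmax: "v w \<le> v f" if "w \<in> ?C" for w unfolding f(2) by (rule Max_ge) (use finV that in auto)
      have fV: "f \<in> V" "v f < v e" using f(1) by auto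
      have fn: "f < n" "zone f = c" "v x \<le> v f" using ex'(11)[OF V'(2)[OF fV(1)]] by auto
      have Cx: "v x \<le> v w" "w < n" if "w \<in> ?C" for w using ex'(11)[OF V'(2), of w] that by auto
      show ?thesis
      proof (cases "f = x")
        case True
        have "w = x" if "w \<in> ?C" for w
          using fmax[OF that] Cx[OF that] True injD[of w x] ex'(1) by simp
        then show ?thesis by (rule sing)
      next
        case False
        then have "v f \<noteq> v x" using injD[of f x] fn ex'(1) by auto
        then have "v x < v f" using fn by simp
        moreover have "x \<le> f"
          using zone_run_position(1)[of e x f] ex'(3) en fn fV late_block(2)[OF V'[OF eV(1)] eV(2)] by simp
        ultimately have "inverted v A g x f"
          using False V'[OF fV(1)] xA gC[OF f(1)] unfolding inverted_def on_top_def by auto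
        then show ?thesis by (rule few) (use fmax Cx in auto)
      qed
    next
      case True
      then show ?thesis by (metis card.empty zero_le)
    qed
    show ?thesis by (rule split[OF _ B C]) auto
  qed
qed

end

text \<open>If the push capacity \<open>a\<close> is finite, \<open>2 * a + 1\<close> sampled
  members prevent \<open>x\<close> and \<open>y\<close> from sharing a block, so the sample is
  stacked in sorted order and the obstacle to one block per run is refuted. If it is infinite, the
  obstacle to a single block is a run too long for a finite \<open>t\<close>;
  \<open>2 * b + 1\<close> members then exclude first that \<open>x\<close> and \<open>y\<close> are
  separated and next that there is a second label, so the run would lie in one block.\<close>

lemma large_zone_whole_or_drops:
  assumes ex: "extremes c x y r" and large: "K \<le> card (members c)"
    and notdrops: "\<not> (enat (card (members c)) \<le> t \<and> (\<forall>k. enat (card {i \<in> members c. drops i = k}) \<le> s))"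
    and notwhole: "\<not> (enat (card (members c)) \<le> s \<and>
      (\<forall>i\<in>members c. \<forall>j\<in>members c. i < j \<longrightarrow> v i < v j \<longrightarrow> enat (Suc (v j - v i)) \<le> t))"
  shows False
proof -
  note e = extremesD[OF ex]
  have Mn: "members c \<subseteq> {..<n}" by (auto simp: members_def)
  have drop: "inverted v A g x y" if "faithful s t A g" "x \<in> A" "y \<in> A" "r \<in> A" "g y \<noteq> g x" for A g
    using faithful_mono[OF that(1,3,2)] inverted_drop[OF that(1) ex that(4,2,3) e(5,6)] e(7,10) that(5) by simp
  show False
  proof (cases s)
    case (enat a)
    obtain V where V: "V \<subseteq> members c" "card V = 2 * a + 1"
      using obtain_subset_with_card_n[of "2 * a + 1" "members c"] large sK[OF enat] by auto
    have main: False if B: "B \<subseteq> members c" "card B + 2 * a + 4 \<le> K"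
      and contra: "\<And>A g. B \<subseteq> A \<Longrightarrow> A \<subseteq> {..<n} \<Longrightarrow> faithful s t A g \<Longrightarrow> inverted v A g x y \<Longrightarrow> False" for B
    proof -
      let ?A = "V \<union> B \<union> {x, y, r}"
      have "card {x, y, r} \<le> 3" by (simp add: card_insert_if)
      then have "card ?A \<le> K"
        using card_Un_le[of "V \<union> B" "{x, y, r}"] card_Un_le[of V B] V B by linarith
      moreover have A: "?A \<subseteq> {..<n}" using V B Mn e(1,2,8) by auto
      ultimately obtain g where g: "faithful s t ?A g" using faith by blast
      have eq: "g y = g x" using drop[OF g] contra[OF _ A g] by auto
      have "card V \<le> 2 * a" by (rule joined_card_le_push[OF g A ex _ _ _ eq _ V(1) enat]) auto
      then show False using V by simp
    qed
    show False
    proof (cases "enat (card (members c)) \<le> t")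
      case True
      then obtain k where "\<not> enat (card {i \<in> members c. drops i = k}) \<le> s" using notdrops by blast
      then obtain m B where B: "s = enat m" "B \<subseteq> {i \<in> members c. drops i = k}" "card B = Suc m"
        by (rule subset_card_exceeding) (use finite_members in auto)
      show False
      proof (rule main)
        show "B \<subseteq> members c" using B by auto
        show "card B + 2 * a + 4 \<le> K" using B enat sK[OF enat] by simp
        fix A g assume A: "B \<subseteq> A" "A \<subseteq> {..<n}" "faithful s t A g" "inverted v A g x y"
        have "enat (card B) \<le> s" by (rule stacked_drops_few[OF A(3,2) ex A(4,1) B(2)])
        then show False using B by simp
      qed
    next
      case False
      then obtain m B where B: "t = enat m" "B \<subseteq> members c" "card B = Suc m"
        by (rule subset_card_exceeding[OF _ finite_members]) auto
      show False
      proof (rule main)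
        show "B \<subseteq> members c" by fact
        show "card B + 2 * a + 4 \<le> K" using B sK[OF enat] tK[OF B(1)] by simp
        fix A g assume A: "B \<subseteq> A" "A \<subseteq> {..<n}" "faithful s t A g" "inverted v A g x y"
        have "enat (card B) \<le> t" by (rule stacked_few[OF A(3,2) ex A(4,1) B(2)])
        then show False using B by simp
      qed
    qed
  next
    case infinity
    then obtain i j where ij: "i \<in> members c" "j \<in> members c" "i < j" "v i < v j" "\<not> enat (Suc (v j - v i)) \<le> t"
      using notwhole by auto
    then have "\<not> enat (card {w. w < n \<and> v i \<le> v w \<and> v w \<le> v j}) \<le> t"
      using card_between[of i j] e(11)[OF ij(1)] e(11)[OF ij(2)] by simp
    then obtain b B where B: "t = enat b" "B \<subseteq> {w. w < n \<and> v i \<le> v w \<and> v w \<le> v j}" "card B = Suc b"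
      by (rule subset_card_exceeding) auto
    obtain V where V: "V \<subseteq> members c" "card V = 2 * b + 1"
      using obtain_subset_with_card_n[of "2 * b + 1" "members c"] large tK[OF B(1)] by auto
    let ?V = "V \<union> B \<union> {i, j}"
    let ?A = "?V \<union> {x, y, r}"
    have VM: "?V \<subseteq> members c" using V B run_members[OF ij(1-4)] ij by blast
    have "card {x, y, r} \<le> 3" "card {i, j} \<le> 2" by (simp_all add: card_insert_if)
    then have "card ?A \<le> K"
      using card_Un_le[of ?V "{x, y, r}"] card_Un_le[of "V \<union> B" "{i, j}"] card_Un_le[of V B] V B tK[OF B(1)] by linarith
    moreover have A: "?A \<subseteq> {..<n}" using VM Mn e(1,2,8) by auto
    ultimately obtain g where g: "faithful s t ?A g" using faith by blast
    have finV: "finite ?V" using VM finite_members finite_subset by blast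
    then have cV: "2 * b + 1 \<le> card ?V" using card_mono[OF finV, of V] V by auto
    have eq: "g y = g x"
    proof (rule ccontr)
      assume "g y \<noteq> g x"
      then have inv: "inverted v ?A g x y" using drop[OF g] by simp
      have "enat (card V) \<le> t" by (rule stacked_few[OF g A ex inv _ V(1)]) auto
      then show False using V B by simp
    qed
    have same: "g w = g x" if "w \<in> ?V" for w
    proof (rule ccontr)
      assume "g w \<noteq> g x"
      have "card ?V \<le> 2 * b"
        by (rule joined_card_le_pop[OF g A ex _ _ _ eq _ VM B(1) that \<open>g w \<noteq> g x\<close>]) auto
      then show False using cV by simp
    qed
    have "g i = g j" using same[of i] same[of j] by simp
    then have inv: "inverted v ?A g i j" using ij by (auto simp: inverted_def on_top_def)
    have "enat (card B) \<le> t" by (rule inverted_few[OF g finite_subset[OF A finite_lessThan] inv]) (use B in auto)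
    then show False using B by simp
  qed
qed

lemma fits_exists: "\<exists>h. fits s t c h"
proof (cases "\<exists>i\<in>members c. \<exists>j\<in>members c. i < j \<and> v j < v i")
  case False
  show ?thesis
  proof (rule fits_run_zone)
    fix i j assume ij: "i \<in> members c" "j \<in> members c" "i < j"
    then have "v i \<noteq> v j" using injD[of i j] by (auto simp: members_def)
    then show "v i < v j" using False ij by (meson nat_neq_iff)
  qed
next
  case True
  then obtain x y r where ex: "extremes c x y r" using extremes_exist by blast
  note e = extremesD[OF ex]
  show ?thesis
  proof (cases "\<exists>a\<in>members c. \<exists>b\<in>members c. forced a b \<and> b < a")
    case True
    then show ?thesis using fits_forced_drop[OF ex] by blast
  next
    case False
    have fw: "a < b" if "a \<in> members c" "b \<in> members c" "forced a b" for a b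
    proof -
      have "a \<noteq> b" using that(3) by (auto simp: forced_def)
      then show ?thesis using False that by (meson nat_neq_iff)
    qed
    show ?thesis
    proof (cases "\<exists>u<n. zone u \<noteq> c \<and> v x < v u \<and> v u < v y")
      case True
      then obtain u where u: "u < n" "zone u \<noteq> c" "v x < v u" "v u < v y" by blast
      show ?thesis using fits_whole[OF fw gap_zone(2)[OF ex u] gap_zone(1)[OF ex u]] by blast
    next
      case False
      then have closed: "zone w = c" if "w < n" "v x < v w" "v w < v y" for w using that by blast
      show ?thesis
      proof (cases "card (members c) < K")
        case True
        then show ?thesis using fits_small_zone[OF ex closed] by blast
      next
        case False
        then consider "enat (card (members c)) \<le> t \<and> (\<forall>k. enat (card {i \<in> members c. drops i = k}) \<le> s)"
          | "enat (card (members c)) \<le> s \<and>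
            (\<forall>i\<in>members c. \<forall>j\<in>members c. i < j \<longrightarrow> v i < v j \<longrightarrow> enat (Suc (v j - v i)) \<le> t)"
          using large_zone_whole_or_drops[OF ex] by (meson not_less)
        then show ?thesis
        proof cases
          case 1
          have "fits s t c drops"
          proof (rule fits_drops)
            fix i j w assume "i \<in> members c" "j \<in> members c" "w < n" "v i < v w" "v w < v j"
            then show "zone w = c" using closed[of w] e(11)[of i] e(11)[of j] by simp
          qed (use 1 in auto)
          then show ?thesis by blast
        next
          case 2
          have "fits s t c (\<lambda>_. 0)" by (rule fits_whole[OF fw]) (use 2 in auto)
          then show ?thesis by blast
        qed
      qed
    qed
  qed
qed

theorem schedule_exists: "\<exists>g. schedule s t v {..<n} g"
proof -
  obtain h where h: "\<And>c. fits s t c (h c)" using fits_exists by metis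
  \<comment> \<open>The labels are combined lexicographically, zone first; \<open>m\<close> exceeds
    every label used inside a zone.\<close>
  define m where "m = Suc (Max (insert 0 ((\<lambda>i. h (zone i) i) ` {..<n})))"
  define g where "g i = zone i * m + h (zone i) i" for i
  have hm: "h (zone i) i < m" if "i < n" for i
    unfolding m_def by (rule le_imp_less_Suc, rule Max_ge) (use that in auto)
  have zless: "g i < g j" if "i < n" "zone i < zone j" for i j
  proof -
    have "g i < Suc (zone i) * m" using hm[OF that(1)] by (simp add: g_def)
    also have "\<dots> \<le> zone j * m" using that(2) by (intro mult_le_mono) auto
    also have "\<dots> \<le> g j" by (simp add: g_def)
    finally show ?thesis .
  qed
  have gz: "zone i \<le> zone j" if "i < n" "j < n" "g i \<le> g j" for i j
    using zless[OF that(2), of i] that(3) by (meson leD not_le_imp_less)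
  have mem: "i \<in> members (zone i)" if "i < n" for i using that by (simp add: members_def)
  have top: "on_top g i j \<longleftrightarrow> on_top (h c) i j" if "zone i = c" "zone j = c" for i j c
    using that by (simp add: on_top_def g_def)
  have forced_top: "on_top g a b" if "forced a b" "a < n" "b < n" for a b
  proof (cases "zone a = zone b")
    case True
    then have "on_top (h (zone b)) a b"
      using fitsD(2)[OF h[of "zone b"], of a b] that mem[of a] mem[of b] by simp
    then show ?thesis using top[of a "zone b" b] True by simp
  next
    case False
    then have "zone b < zone a" using forced_zones[OF that] by simp
    then show ?thesis using zless[of b a] that by (simp add: on_top_def)
  qed
  have lands: "lands_on i j" if inv: "inverted v {..<n} g i j" and z: "zone i \<noteq> zone j" for i j
  proof -
    have ij: "i < n" "j < n" "v i < v j" "on_top g i j" using inv by (auto simp: inverted_def)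
    have "g j \<le> g i" using ij(4) by (auto simp: on_top_def)
    then have zz: "zone j < zone i" using gz[of j i] ij z by simp
    then have "g i \<noteq> g j" using zless[of j i] ij by simp
    then obtain k where k: "k < n" "g i \<le> g k" "v j < v k" using inv by (auto simp: inverted_def)
    \<comment> \<open>The larger \<open>k\<close> in \<open>inverted\<close> may precede
      \<open>i\<close>. It is then in the zone of \<open>i\<close>, and
      \<open>zone_later_larger\<close> replaces it by an entry after \<open>i\<close>, as
      \<open>lands_on\<close> requires.\<close>
    have "\<exists>r>i. r < n \<and> v j < v r"
    proof (cases "i < k")
      case True then show ?thesis using k by blast
    next
      case False
      then have "k < i" using k ij by (cases "k = i") auto
      moreover have "zone k = zone i" using gz[of i k] zone_mono[of k i] k ij \<open>k < i\<close> by simp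
      ultimately obtain r where "r > i" "r < n" "v k < v r" using zone_later_larger[of k i] k ij by auto
      then show ?thesis using k by (intro exI[of _ r]) simp
    qed
    then show ?thesis using ij zz unfolding lands_on_def by blast
  qed
  have inside: "j < i \<and> h (zone j) j < h (zone j) i \<or> i < j \<and> h (zone j) i = h (zone j) j"
    if "inverted v {..<n} g i j" "zone i = zone j" for i j
  proof -
    have ij: "i < n" "j < n" "on_top (h (zone j)) i j"
      using that top[of i "zone j" j] by (auto simp: inverted_def)
    show ?thesis
    proof (cases "h (zone j) i = h (zone j) j")
      case False
      then have lt: "h (zone j) j < h (zone j) i" using ij by (auto simp: on_top_def)
      have "\<not> i \<le> j" using fitsD(1)[OF h[of "zone j"], of i j] mem[of i] mem[of j] ij that(2) lt by auto
      then show ?thesis using lt by simp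
    qed (use ij in \<open>auto simp: on_top_def\<close>)
  qed
  have "schedule s t v {..<n} g"
    unfolding schedule_def
  proof (intro conjI ballI allI impI)
    fix i j assume ij: "i \<in> {..<n}" "j \<in> {..<n}" "i \<le> j"
    show "g i \<le> g j"
    proof (cases "zone i = zone j")
      case True
      then have "h (zone j) i \<le> h (zone j) j"
        using fitsD(1)[OF h[of "zone j"], of i j] mem[of i] mem[of j] ij by simp
      then show ?thesis using True by (simp add: g_def)
    next
      case False
      then have "zone i < zone j" using zone_mono[of i j] ij by simp
      then show ?thesis using zless[of i j] ij by simp
    qed
  next
    fix i j w assume w: "w \<in> {..<n}" "inverted v {..<n} g i j" "v i < v w" "v w < v j"
    then have ij: "i < n" "j < n" by (auto simp: inverted_def)
    have "on_top g i w \<and> on_top g w j"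
    proof (cases "zone i = zone j")
      case False
      have l: "lands_on i j" by (rule lands[OF w(2) False])
      have "forced i w" "forced w j"
        unfolding forced_def by (intro conjI exI[of _ i] exI[of _ j]; use l w(3,4) in simp)+
      then show ?thesis using forced_top[of i w] forced_top[of w j] w(1) ij by simp
    next
      case True
      show ?thesis using inside[OF w(2) True]
      proof
        assume a: "j < i \<and> h (zone j) j < h (zone j) i"
        have "zone w = zone j \<and> on_top (h (zone j)) i w \<and> on_top (h (zone j)) w j"
          by (rule fitsD(4)[OF h]) (use a w ij mem[of i] mem[of j] True in auto)
        then show ?thesis using top[of i "zone j" w] top[of w "zone j" j] True by simp
      next
        assume a: "i < j \<and> h (zone j) i = h (zone j) j"
        have p: "i \<le> w" "w \<le> j" "zone w = zone j"
          using zone_run_position[of j i w] a ij w True by simp_all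
        have ne: "w \<noteq> i" "w \<noteq> j" using w by auto
        have "h (zone j) i \<le> h (zone j) w" "h (zone j) w \<le> h (zone j) j"
          using fitsD(1)[OF h[of "zone j"], of i w] fitsD(1)[OF h[of "zone j"], of w j] p mem[of i] mem[of j] mem[of w] ij w(1) True by simp_all
        then have "h (zone j) w = h (zone j) i" "h (zone j) w = h (zone j) j" using a by simp_all
        then show ?thesis using p ne True by (simp add: on_top_def g_def)
      qed
    qed
    then show "on_top g i w" "on_top g w j" by simp_all
  next
    fix i j assume inv: "inverted v {..<n} g i j"
    then have ij: "i < n" "j < n" "v i < v j" by (auto simp: inverted_def)
    have "enat (Suc (v j - v i)) \<le> t"
    proof (cases "zone i = zone j")
      case False
      show ?thesis by (rule lands_on_length[OF lands[OF inv False]])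
    next
      case True
      have M: "i \<in> members (zone j)" "j \<in> members (zone j)" using mem[of i] mem[of j] ij True by simp_all
      show ?thesis using inside[OF inv True] fitsD(3)[OF h M] fitsD(5)[OF h M] ij(3) by blast
    qed
    then show "enat (card {w \<in> {..<n}. v i \<le> v w \<and> v w \<le> v j}) \<le> t"
      using card_between[of i j] ij by simp
  next
    fix k
    show "enat (card {i \<in> {..<n}. g i = k}) \<le> s"
    proof (cases "\<exists>i<n. g i = k")
      case True
      then obtain i where i: "i < n" "g i = k" by blast
      have "{j \<in> {..<n}. g j = k} \<subseteq> {j \<in> members (zone i). h (zone i) j = h (zone i) i}"
      proof
        fix j assume "j \<in> {j \<in> {..<n}. g j = k}"
        then have j: "j < n" "g j = g i" using i by simp_all
        then have "zone j = zone i" using gz[of i j] gz[of j i] i by simp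
        then show "j \<in> {j \<in> members (zone i). h (zone i) j = h (zone i) i}"
          using j by (simp add: members_def g_def)
      qed
      then have "card {j \<in> {..<n}. g j = k} \<le> card {j \<in> members (zone i). h (zone i) j = h (zone i) i}"
        by (rule card_mono[rotated]) (simp add: finite_members)
      then show ?thesis using fitsD(6)[OF h[of "zone i"], of "h (zone i) i"] by (meson enat_ord_simps(1) order_trans)
    next
      case False
      then have none: "{i \<in> {..<n}. g i = k} = {}" by blast
      show ?thesis unfolding none by (simp add: zero_enat_def[symmetric])
    qed
  qed
  then show ?thesis by blast
qed

end

section \<open>Involvement and the basis\<close>

lemma subseq_positions:
  "subseq q p \<Longrightarrow> \<exists>f. (\<forall>i<length q. f i < length p \<and> q ! i = p ! f i) \<and> (\<forall>i j. i < j \<longrightarrow> j < length q \<longrightarrow> f i < f j)"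
proof (induction q p rule: list_emb.induct)
  case (list_emb_Nil ys)
  then show ?case by simp
next
  case (list_emb_Cons xs ys y)
  then obtain f where f: "\<And>i. i < length xs \<Longrightarrow> f i < length ys \<and> xs ! i = ys ! f i"
    "\<And>i j. i < j \<Longrightarrow> j < length xs \<Longrightarrow> f i < f j" by blast
  then show ?case by (intro exI[of _ "\<lambda>i. Suc (f i)"]) simp
next
  case (list_emb_Cons2 x y xs ys)
  then obtain f where f: "\<And>i. i < length xs \<Longrightarrow> f i < length ys \<and> xs ! i = ys ! f i"
    "\<And>i j. i < j \<Longrightarrow> j < length xs \<Longrightarrow> f i < f j" by blast
  then show ?case
    using list_emb_Cons2.hyps(1)
    by (intro exI[of _ "\<lambda>i. case i of 0 \<Rightarrow> 0 | Suc j \<Rightarrow> Suc (f j)"]) (auto split: nat.splits simp: nth_Cons)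
qed

lemma involvedI:
  assumes f: "\<And>i. i < length \<sigma> \<Longrightarrow> f i < length \<pi>"
    "\<And>i j. i < j \<Longrightarrow> j < length \<sigma> \<Longrightarrow> f i < f j"
    "\<And>i j. i < length \<sigma> \<Longrightarrow> j < length \<sigma> \<Longrightarrow> \<pi> ! f i < \<pi> ! f j \<longleftrightarrow> \<sigma> ! i < \<sigma> ! j"
  shows "involved \<sigma> \<pi>"
proof -
  let ?ps = "map f [0..<length \<sigma>]" and ?q = "map (\<lambda>i. \<pi> ! f i) [0..<length \<sigma>]"
  have "sorted_wrt (<) ?ps" unfolding sorted_wrt_map
    by (rule sorted_wrt_mono_rel[OF _ sorted_wrt_upt]) (use f(2) in auto)
  moreover have "sorted_wrt (<) (filter (\<lambda>i. i \<in> set ?ps) [0..<length \<pi>])"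
    by (rule sorted_wrt_filter[OF sorted_wrt_upt])
  moreover have "set ?ps = set (filter (\<lambda>i. i \<in> set ?ps) [0..<length \<pi>])" using f(1) by auto
  ultimately have "?ps = filter (\<lambda>i. i \<in> set ?ps) [0..<length \<pi>]"
    using strict_sorted_equal by blast
  then have "subseq ?ps [0..<length \<pi>]" by (metis subseq_filter_left)
  then have "subseq (map ((!) \<pi>) ?ps) (map ((!) \<pi>) [0..<length \<pi>])" by (rule subseq_map)
  then have "subseq ?q \<pi>" by (simp add: map_nth comp_def)
  moreover have "order_iso ?q \<sigma>" using f(3) by (simp add: order_iso_def)
  ultimately show ?thesis unfolding involved_def by blast
qed

lemma involvedE:
  assumes "involved \<sigma> \<pi>"
  obtains f where "\<And>i. i < length \<sigma> \<Longrightarrow> f i < length \<pi>"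
    "\<And>i j. i < j \<Longrightarrow> j < length \<sigma> \<Longrightarrow> f i < f j"
    "\<And>i j. i < length \<sigma> \<Longrightarrow> j < length \<sigma> \<Longrightarrow> \<pi> ! f i < \<pi> ! f j \<longleftrightarrow> \<sigma> ! i < \<sigma> ! j"
proof -
  obtain q where q: "subseq q \<pi>" "order_iso q \<sigma>" using assms unfolding involved_def by blast
  obtain f where f: "\<And>i. i < length q \<Longrightarrow> f i < length \<pi> \<and> q ! i = \<pi> ! f i"
    "\<And>i j. i < j \<Longrightarrow> j < length q \<Longrightarrow> f i < f j" using subseq_positions[OF q(1)] by blast
  have len: "length q = length \<sigma>" and iso: "\<And>i j. i < length \<sigma> \<Longrightarrow> j < length \<sigma> \<Longrightarrow> q ! i < q ! j \<longleftrightarrow> \<sigma> ! i < \<sigma> ! j"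
    using q(2) by (auto simp: order_iso_def)
  show thesis
  proof (rule that)
    fix i j assume "i < length \<sigma>" "j < length \<sigma>"
    then show "\<pi> ! f i < \<pi> ! f j \<longleftrightarrow> \<sigma> ! i < \<sigma> ! j" using iso[of i j] f(1)[of i] f(1)[of j] len by simp
  qed (use f len in auto)
qed

lemma involved_refl: "involved \<pi> \<pi>"
  by (rule involvedI[of _ id]) auto

lemma involved_trans:
  assumes "involved \<rho> \<sigma>" "involved \<sigma> \<pi>" shows "involved \<rho> \<pi>"
proof -
  obtain f where f: "\<And>i. i < length \<rho> \<Longrightarrow> f i < length \<sigma>" "\<And>i j. i < j \<Longrightarrow> j < length \<rho> \<Longrightarrow> f i < f j"
    "\<And>i j. i < length \<rho> \<Longrightarrow> j < length \<rho> \<Longrightarrow> \<sigma> ! f i < \<sigma> ! f j \<longleftrightarrow> \<rho> ! i < \<rho> ! j"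
    using involvedE[OF assms(1)] by blast
  obtain h where h: "\<And>i. i < length \<sigma> \<Longrightarrow> h i < length \<pi>" "\<And>i j. i < j \<Longrightarrow> j < length \<sigma> \<Longrightarrow> h i < h j"
    "\<And>i j. i < length \<sigma> \<Longrightarrow> j < length \<sigma> \<Longrightarrow> \<pi> ! h i < \<pi> ! h j \<longleftrightarrow> \<sigma> ! i < \<sigma> ! j"
    using involvedE[OF assms(2)] by blast
  show ?thesis
    by (rule involvedI[of _ "h \<circ> f"]) (use f h in auto)
qed

lemma involved_length: "involved \<sigma> \<pi> \<Longrightarrow> length \<sigma> \<le> length \<pi>"
  unfolding involved_def order_iso_def using list_emb_length by fastforce

lemma is_perm_bij: "is_perm p \<Longrightarrow> bij_betw ((!) p) {..<length p} {1..length p}"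
  by (simp add: is_perm_def bij_betw_nth)

text \<open>A permutation can be recovered from its order relations, which yields the uniqueness in
  \<open>involved_eq_length\<close>.\<close>

lemma perm_rank:
  assumes "is_perm p" "i < length p"
  shows "p ! i = Suc (card {j. j < length p \<and> p ! j < p ! i})"
proof -
  interpret perm_values "length p" "(!) p" by unfold_locales (rule is_perm_bij[OF assms(1)])
  let ?S = "{j. j < length p \<and> p ! j < p ! i}"
  have "(!) p ` ?S = {1..<p ! i}"
  proof
    show "(!) p ` ?S \<subseteq> {1..<p ! i}" using val_le by auto
    show "{1..<p ! i} \<subseteq> (!) p ` ?S"
    proof
      fix x assume x: "x \<in> {1..<p ! i}"
      then obtain k where "k < length p" "p ! k = x" using position_of[of x] val_le[OF assms(2)] by auto
      then show "x \<in> (!) p ` ?S" using x by auto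
    qed
  qed
  moreover have "inj_on ((!) p) ?S" using inj by (rule inj_on_subset) auto
  ultimately have "card ?S = p ! i - 1" using card_image[of "(!) p" ?S] by simp
  then show ?thesis using val_le[OF assms(2)] by simp
qed

lemma involved_eq_length:
  assumes "is_perm \<sigma>" "is_perm \<pi>" "involved \<sigma> \<pi>" "length \<sigma> = length \<pi>"
  shows "\<sigma> = \<pi>"
proof -
  obtain q where q: "subseq q \<pi>" "order_iso q \<sigma>" using assms(3) unfolding involved_def by blast
  then have "q = \<pi>" using subseq_same_length assms(4) by (auto simp: order_iso_def)
  then have iso: "\<pi> ! i < \<pi> ! j \<longleftrightarrow> \<sigma> ! i < \<sigma> ! j" if "i < length \<pi>" "j < length \<pi>" for i j
    using q that by (auto simp: order_iso_def)
  show ?thesis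
  proof (rule nth_equalityI[OF assms(4)])
    fix i assume i: "i < length \<sigma>"
    have "{j. j < length \<sigma> \<and> \<sigma> ! j < \<sigma> ! i} = {j. j < length \<pi> \<and> \<pi> ! j < \<pi> ! i}"
      using iso i assms(4) by auto
    then show "\<sigma> ! i = \<pi> ! i" using perm_rank[OF assms(1) i] perm_rank[OF assms(2), of i] i assms(4) by simp
  qed
qed

lemma F_iff_schedule:
  assumes "is_perm p" "1 \<le> t"
  shows "p \<in> F s t \<longleftrightarrow> (\<exists>g. schedule s t ((!) p) {..<length p} g)"
  using sortable_imp_schedule[of s t p] schedule_imp_sortable[OF assms(1) _ assms(2), of s] assms(1)
  by (auto simp: F_def)

lemma F_closed:
  assumes "\<pi> \<in> F s t" "is_perm \<sigma>" "involved \<sigma> \<pi>" "1 \<le> t"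
  shows "\<sigma> \<in> F s t"
proof -
  have "is_perm \<pi>" using assms(1) by (simp add: F_def)
  then obtain g where g: "schedule s t ((!) \<pi>) {..<length \<pi>} g" using assms F_iff_schedule by blast
  obtain f where f: "\<And>i. i < length \<sigma> \<Longrightarrow> f i < length \<pi>" "\<And>i j. i < j \<Longrightarrow> j < length \<sigma> \<Longrightarrow> f i < f j"
    "\<And>i j. i < length \<sigma> \<Longrightarrow> j < length \<sigma> \<Longrightarrow> \<pi> ! f i < \<pi> ! f j \<longleftrightarrow> \<sigma> ! i < \<sigma> ! j"
    using involvedE[OF assms(3)] by blast
  have "schedule s t ((!) \<sigma>) {..<length \<sigma>} (g \<circ> f)"
    by (rule schedule_embed[OF g]) (use f in auto)
  then show ?thesis using F_iff_schedule[OF assms(2,4)] by blast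
qed

text \<open>The entries of \<open>\<tau>\<close> are the ranks of the values on \<open>W\<close>,
  and \<open>f\<close> sends a position to its index in \<open>W\<close>. The map is exposed because
  schedules of \<open>\<tau>\<close> are pulled back along it.\<close>

lemma standardize:
  assumes p: "is_perm p" and W: "W \<subseteq> {..<length p}"
  obtains \<tau> f where "is_perm \<tau>" "involved \<tau> p" "length \<tau> = card W"
    "\<And>i. i \<in> W \<Longrightarrow> f i < length \<tau>" "\<And>i j. i \<in> W \<Longrightarrow> j \<in> W \<Longrightarrow> i < j \<Longrightarrow> f i < f j"
    "\<And>i j. i \<in> W \<Longrightarrow> j \<in> W \<Longrightarrow> p ! i < p ! j \<longleftrightarrow> \<tau> ! f i < \<tau> ! f j"
proof -
  interpret perm_values "length p" "(!) p" by unfold_locales (rule is_perm_bij[OF p])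
  have fin: "finite W" using W finite_subset by blast
  define ps where "ps = sorted_list_of_set W"
  define rank where "rank i = Suc (card {j\<in>W. p ! j < p ! i})" for i
  define f where "f i = card {j\<in>W. j < i}" for i
  define \<tau> where "\<tau> = map rank ps"
  have ps: "set ps = W" "length ps = card W" "sorted_wrt (<) ps" using fin by (simp_all add: ps_def)
  have inj_p: "i = j" if "p ! i = p ! j" "i \<in> W" "j \<in> W" for i j using injD[of i j] that W by auto
  have rank_less: "rank i < rank j" if "i \<in> W" "j \<in> W" "p ! i < p ! j" for i j
  proof -
    have "{k\<in>W. p ! k < p ! i} \<subset> {k\<in>W. p ! k < p ! j}" using that by force
    then show ?thesis unfolding rank_def using fin by (simp add: psubset_card_mono)
  qed
  have rank_iff: "rank i < rank j \<longleftrightarrow> p ! i < p ! j" if "i \<in> W" "j \<in> W" for i j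
    using rank_less[of i j] rank_less[of j i] inj_p[of i j] that
    by (cases "p ! i" "p ! j" rule: linorder_cases) simp_all
  have inj_rank: "inj_on rank W"
  proof (rule inj_onI)
    fix i j assume "i \<in> W" "j \<in> W" "rank i = rank j"
    then show "i = j"
      using rank_less[of i j] rank_less[of j i] inj_p[of i j] by (cases "p ! i" "p ! j" rule: linorder_cases) simp_all
  qed
  have psW: "ps ! a \<in> W" if "a < card W" for a
    using nth_mem[of a ps] that ps(1,2) by simp
  have f: "ps ! f i = i" "f i < card W" if "i \<in> W" for i
  proof -
    have "i \<in> set ps" using that ps(1) by simp
    then obtain a where a: "a < card W" "ps ! a = i" unfolding in_set_conv_nth ps(2) by blast
    have "{j\<in>W. j < i} = (!) ps ` {..<a}"
    proof
      show "(!) ps ` {..<a} \<subseteq> {j\<in>W. j < i}"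
        using psW a sorted_wrt_nth_less[OF ps(3)] ps(2) by auto
      show "{j\<in>W. j < i} \<subseteq> (!) ps ` {..<a}"
      proof
        fix j assume j: "j \<in> {j\<in>W. j < i}"
        then have "j \<in> set ps" using ps(1) by simp
        then obtain b where b: "b < card W" "ps ! b = j" unfolding in_set_conv_nth ps(2) by blast
        have "b < a"
        proof (rule ccontr)
          assume "\<not> b < a"
          then have "i \<le> j" using sorted_wrt_nth_less[OF ps(3), of a b] a b ps(2) by (cases "a = b") auto
          then show False using j by simp
        qed
        then show "j \<in> (!) ps ` {..<a}" using b by auto
      qed
    qed
    moreover have "inj_on ((!) ps) {..<a}"
      using a ps by (intro inj_on_nth) (auto simp: ps_def)
    ultimately have "f i = a" by (simp add: f_def card_image)
    then show "ps ! f i = i" "f i < card W" using a by simp_all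
  qed
  have \<tau>_nth: "\<tau> ! a = rank (ps ! a)" if "a < card W" for a using that ps by (simp add: \<tau>_def)
  show thesis
  proof (rule that)
    have "rank i \<in> {1..card W}" if "i \<in> W" for i
    proof -
      have "{j\<in>W. p ! j < p ! i} \<subset> W" using that by auto
      then show ?thesis unfolding rank_def using psubset_card_mono[OF fin] by (simp add: Suc_le_eq)
    qed
    then have "rank ` W \<subseteq> {1..card W}" by blast
    then have "rank ` W = {1..card W}" using card_image[OF inj_rank] by (intro card_subset_eq) auto
    then show "is_perm \<tau>" unfolding is_perm_def \<tau>_def
      using inj_rank ps by (simp add: distinct_map ps_def fin)
    show "length \<tau> = card W" using ps by (simp add: \<tau>_def)
    show "involved \<tau> p"
    proof (rule involvedI[of _ "(!) ps"])
      fix i j assume "i < length \<tau>" "j < length \<tau>"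
      then show "p ! (ps ! i) < p ! (ps ! j) \<longleftrightarrow> \<tau> ! i < \<tau> ! j"
        using \<tau>_nth[of i] \<tau>_nth[of j] psW[of i] psW[of j] rank_iff ps(2) by (simp add: \<tau>_def)
    next
      fix i assume "i < length \<tau>"
      then show "ps ! i < length p" using psW[of i] W ps(2) by (auto simp: \<tau>_def)
    next
      fix i j assume "i < j" "j < length \<tau>"
      then show "ps ! i < ps ! j" using sorted_wrt_nth_less[OF ps(3)] by (simp add: \<tau>_def)
    qed
    fix i j assume ij: "i \<in> W" "j \<in> W"
    show "p ! i < p ! j \<longleftrightarrow> \<tau> ! f i < \<tau> ! f j"
      using \<tau>_nth[of "f i"] \<tau>_nth[of "f j"] f[OF ij(1)] f[OF ij(2)] rank_iff[OF ij] by simp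
    assume "i < j"
    then have "{k\<in>W. k < i} \<subset> {k\<in>W. k < j}" using ij by force
    then show "f i < f j" unfolding f_def using fin by (simp add: psubset_card_mono)
  next
    fix i assume "i \<in> W"
    then show "f i < length \<tau>" using f(2)[of i] ps by (simp add: \<tau>_def)
  qed
qed

text \<open>In a longer minimal permutation any \<open>N\<close> positions standardise to a proper
  pattern, which is sortable by minimality. Thus all small samples have schedules, which already
  yields a schedule of the whole.\<close>

lemma U_length_bounded:
  assumes s: "1 \<le> s" and t: "1 \<le> t"
  shows "\<exists>N. \<forall>\<sigma>\<in>U s t. length \<sigma> \<le> N"
proof -
  \<comment> \<open>the_enat is unspecified at infinity, where no bound is needed\<close>
  define K where "K = 6 * the_enat s + 6 * the_enat t + 20"
  define N where "N = K + 9 * (K * K)"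
  have "length \<sigma> \<le> N" if \<sigma>: "\<sigma> \<in> U s t" for \<sigma>
  proof (rule ccontr)
    assume long: "\<not> length \<sigma> \<le> N"
    have perm: "is_perm \<sigma>" and notF: "\<sigma> \<notin> F s t"
      and min: "\<And>\<tau>. is_perm \<tau> \<Longrightarrow> involved \<tau> \<sigma> \<Longrightarrow> \<tau> \<noteq> \<sigma> \<Longrightarrow> \<tau> \<in> F s t"
      using \<sigma> by (auto simp: U_def)
    interpret perm_values "length \<sigma>" "(!) \<sigma>" by unfold_locales (rule is_perm_bij[OF perm])
    have small: "\<exists>g. schedule s t ((!) \<sigma>) W g" if W: "W \<subseteq> {..<length \<sigma>}" "card W \<le> N" for W
    proof -
      obtain \<tau> f where \<tau>: "is_perm \<tau>" "involved \<tau> \<sigma>" "length \<tau> = card W"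
        and f: "\<And>i. i \<in> W \<Longrightarrow> f i < length \<tau>" "\<And>i j. i \<in> W \<Longrightarrow> j \<in> W \<Longrightarrow> i < j \<Longrightarrow> f i < f j"
          "\<And>i j. i \<in> W \<Longrightarrow> j \<in> W \<Longrightarrow> \<sigma> ! i < \<sigma> ! j \<longleftrightarrow> \<tau> ! f i < \<tau> ! f j"
        using standardize[OF perm W(1)] by blast
      have "\<tau> \<noteq> \<sigma>" using \<tau>(3) W(2) long by auto
      then have "\<tau> \<in> F s t" using min \<tau> by blast
      then obtain g where g: "schedule s t ((!) \<tau>) {..<length \<tau>} g" using F_iff_schedule[OF \<tau>(1) t] by blast
      have "schedule s t ((!) \<sigma>) W (g \<circ> f)" by (rule schedule_embed[OF g]) (use f in auto)
      then show ?thesis by blast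
    qed
    interpret locally_schedulable "length \<sigma>" "(!) \<sigma>" s t K
    proof
      fix A assume A: "A \<subseteq> {..<length \<sigma>}" "card A \<le> K"
      have "card A + 9 * (card A * card A) \<le> N"
        unfolding N_def using A(2) mult_le_mono[OF A(2) A(2)] by linarith
      then show "\<exists>g. faithful s t A g" using faithful_exists[OF small A(1)] by blast
    qed (use s t in \<open>auto simp: K_def\<close>)
    show False using schedule_exists notF F_iff_schedule[OF perm t] by blast
  qed
  then show ?thesis by blast
qed

theorem mainTheorem2:
  fixes s t :: enat
  assumes "s \<ge> 1" and "t \<ge> 1"
  shows "finite (U s t) \<and>
    (\<exists>B. finite B \<and> (\<forall>\<sigma>\<in>B. is_perm \<sigma>) \<and>
       (\<forall>\<pi>. is_perm \<pi> \<longrightarrow> (\<pi> \<in> F s t \<longleftrightarrow> (\<forall>\<sigma>\<in>B. \<not> involved \<sigma> \<pi>))))"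
proof -
  obtain N where N: "\<And>\<sigma>. \<sigma> \<in> U s t \<Longrightarrow> length \<sigma> \<le> N" using U_length_bounded[OF assms] by blast
  have "U s t \<subseteq> {xs. set xs \<subseteq> {1..N} \<and> length xs \<le> N}"
  proof
    fix \<sigma> assume \<sigma>: "\<sigma> \<in> U s t"
    then have "set \<sigma> = {1..length \<sigma>}" by (simp add: U_def is_perm_def)
    then show "\<sigma> \<in> {xs. set xs \<subseteq> {1..N} \<and> length xs \<le> N}" using N[OF \<sigma>] by auto
  qed
  then have fin: "finite (U s t)" by (rule finite_subset) (simp add: finite_lists_length_le)
  \<comment> \<open>Descent on the length terminates because an involved permutation of the same
    length is equal.\<close>
  have below: "\<exists>\<sigma>\<in>U s t. involved \<sigma> \<pi>" if "is_perm \<pi>" "\<pi> \<notin> F s t" for \<pi>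
    using that
  proof (induction "length \<pi>" arbitrary: \<pi> rule: less_induct)
    case less
    show ?case
    proof (cases "\<pi> \<in> U s t")
      case True then show ?thesis using involved_refl by blast
    next
      case False
      then obtain \<tau> where \<tau>: "is_perm \<tau>" "involved \<tau> \<pi>" "\<tau> \<noteq> \<pi>" "\<tau> \<notin> F s t"
        using less.prems by (auto simp: U_def)
      have "length \<tau> < length \<pi>"
        using involved_length[OF \<tau>(2)] involved_eq_length[OF \<tau>(1) less.prems(1) \<tau>(2)] \<tau>(3) by linarith
      then show ?thesis using less.hyps[of \<tau>] \<tau> involved_trans by blast
    qed
  qed
  have "\<pi> \<in> F s t \<longleftrightarrow> (\<forall>\<sigma>\<in>U s t. \<not> involved \<sigma> \<pi>)" if "is_perm \<pi>" for \<pi>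
  proof
    assume "\<pi> \<in> F s t"
    then show "\<forall>\<sigma>\<in>U s t. \<not> involved \<sigma> \<pi>" using F_closed[OF _ _ _ assms(2)] by (auto simp: U_def)
  next
    assume "\<forall>\<sigma>\<in>U s t. \<not> involved \<sigma> \<pi>"
    then show "\<pi> \<in> F s t" using below that by blast
  qed
  moreover have "\<forall>\<sigma>\<in>U s t. is_perm \<sigma>" by (simp add: U_def)
  ultimately show ?thesis using fin by blast
qed

end
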